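(* Let $k\in\{1,2,\dots\}\cup\{\infty\}$ and let $(Q_i,\,0\le i\le k)$ be a sequence of translation invariant transition matrices on $\mathbb{Z}^2$. Assume that for all $1\le i\le k$, $Q_i$ is successfully coupled with $Q_0$. Assume further that $Q_0$ satisfies property (F), that $P_0=\varphi(Q_0)$ is recurrent, and that there is some $p>0$, independent of $i$, such that every $Q_i$, $1\le i\le k$, satisfies property $C(p)$. Then for any process $(S_0,(S_n,i(n))_{n\ge1})$ that satisfies (CL) with $P_i=\varphi(Q_i)$, $1\le i\le k$, the process $\{S_n\}_{n\ge0}$ is recurrent.
   Context: Notation: $\mathbb{N}_k=\{1,\dots,k\}$, and when $k=\infty$ the index $i$ runs over all positive integers. Property (F) and $\varphi$: for a transition matrix $Q$ on $\mathbb{Z}^2$, let $(U,V)$ be a Markov chain with transition matrix $Q$ started at $(0,0)$ and $T=T(Q)=\inf\{n>0: V(n)=0\}$. $Q$ satisfies (F) if $T$ is a.s. finite; then $\varphi(Q)$ denotes the law of $U_T$, a probability law on $\mathbb{Z}$. (Under the hypotheses of the claim every $Q_i$, $1\le i\le k$, satisfies (F), so $\varphi(Q_i)$ is defined.) Translation invariance: $Q[(u,v),(u',v')]=Q[(0,v),(u'-u,v')]$ for all $u,u',v,v'\in\mathbb{Z}$. Successful coupling: for translation invariant $Q,Q_0$, "$Q$ is successfully coupled with $Q_0$" means there is a transition matrix $\widehat Q$ on $\mathbb{Z}^3$ such that (i) $\sum_{w'}\widehat Q((u,v,w),(u',v',w'))=Q_0((u,v),(u',v'))$ for all $u,v,w,u',v'$;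 (ii) $\sum_{v'}\widehat Q((u,v,w),(u',v',w'))=Q((u,w),(u',w'))$ for all $u,v,w,u',w'$; (iii) $\widehat Q((u,v,w),(u',v',w'))=0$ whenever $|w|\le|v|+1$ and $|w'|>|v'|+1$. Property $C(p)$ for $Q$: let $(U,W)$ be the Markov chain with transition matrix $Q$, and let $\mathcal{B}$ be the event that $(U,W)$ visits the horizontal axis $\mathbb{Z}\times\{0\}$ at some time $\ge1$ and does so first (among times $\ge 1$) at the origin. $C(p)$ holds if the probability of $\mathcal{B}$ is at least $p$ both when the chain starts at $(0,1)$ and when it starts at $(0,-1)$. Recurrence: a process on $\mathbb{Z}$ is recurrent if for any $u\in\mathbb{Z}$ it visits $u$ infinitely often, almost surely. A law on $\mathbb{Z}$ is recurrent if the random walk with i.i.d. steps of that law is recurrent. (CL): given laws $(P_i)_{i\in\mathbb{N}_k}$ on $\mathbb{Z}$, a process $(S_0,(S_n,i(n))_{n\ge1})$ with $S_n\in\mathbb{Z}$ and $i(n)\in\mathbb{N}_k$ satisfies (CL) if for all $n\ge0$ the conditional law of $X_{n+1}=S_{n+1}-S_n$ given $\mathcal{H}_n\vee\sigma(i(n+1))$ is $P_{i(n+1)}$, where $\mathcal{H}_n=\sigma(S_0)\vee\sigma((S_\ell,i(\ell))_{1\le\ell\le n})$. *)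

theory Defs
  imports "HOL-Probability.Probability" "HOL-Library.Extended_Nat"
begin

text \<open>
  A transition matrix on a countable state space is a map \<open>Q\<close> from states to pmfs, with
  entries \<open>Q(x, y) = pmf (Q x) y\<close>.  \<open>chain_law Q x\<close> is the law, on path space, of the Markov
  chain with transition matrix \<open>Q\<close> started at \<open>x\<close> at time \<open>0\<close>, obtained from the
  Ionescu-Tulcea theorem.
\<close>

definition chain_step ::
    "('s \<Rightarrow> 's pmf) \<Rightarrow> 's \<Rightarrow> nat \<Rightarrow> (nat \<Rightarrow> 's) \<Rightarrow> 's measure" where
  "chain_step Q x n \<omega> = measure_pmf (case n of 0 \<Rightarrow> return_pmf x | Suc m \<Rightarrow> Q (\<omega> m))"

definition chain_law :: "('s \<Rightarrow> 's pmf) \<Rightarrow> 's \<Rightarrow> (nat \<Rightarrow> 's) measure" where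
  "chain_law Q x =
     projective_family.lim UNIV
       (Ionescu_Tulcea.CI (chain_step Q x) (\<lambda>_. count_space UNIV)) (\<lambda>_. count_space UNIV)"

lemma Ionescu_Tulcea_chain_step:
  fixes Q :: "'s :: countable \<Rightarrow> 's pmf"
  shows "Ionescu_Tulcea (chain_step Q x) (\<lambda>_. count_space UNIV)"
proof (rule Ionescu_Tulcea.intro)
  fix i
  show "chain_step Q x i \<in> PiM {0..<i} (\<lambda>_. count_space UNIV) \<rightarrow>\<^sub>M subprob_algebra (count_space UNIV)"
  proof (cases i)
    case 0
    then show ?thesis
      by (auto simp: chain_step_def[abs_def] space_subprob_algebra
          intro!: measurable_const prob_space_imp_subprob_space prob_space_measure_pmf)
  next
    case (Suc m)
    have "(\<lambda>\<omega>. measure_pmf (Q (\<omega> m))) \<in>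
        PiM {0..<i} (\<lambda>_. count_space UNIV) \<rightarrow>\<^sub>M subprob_algebra (count_space UNIV)"
    proof (rule measurable_compose[where f = "\<lambda>\<omega>. \<omega> m" and g = "\<lambda>y. measure_pmf (Q y)"])
      show "(\<lambda>\<omega>. \<omega> m) \<in> PiM {0..<i} (\<lambda>_. count_space UNIV) \<rightarrow>\<^sub>M count_space (UNIV :: 's set)"
        using measurable_component_singleton[of m "{0..<i}" "\<lambda>_. count_space (UNIV :: 's set)"] by (simp add: Suc)
      show "(\<lambda>y. measure_pmf (Q y)) \<in> count_space UNIV \<rightarrow>\<^sub>M subprob_algebra (count_space UNIV)"
        by (auto simp: space_subprob_algebra measure_pmf.subprob_space_axioms)
    qed
    then show ?thesis by (simp add: chain_step_def[abs_def] Suc)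
  qed
next
  fix i :: nat and \<omega> :: "nat \<Rightarrow> 's"
  show "prob_space (chain_step Q x i \<omega>)"
    by (simp add: chain_step_def prob_space_measure_pmf)
qed

lemma
  fixes Q :: "'s :: countable \<Rightarrow> 's pmf"
  shows sets_chain_law: "sets (chain_law Q x) = sets (PiM UNIV (\<lambda>_. count_space UNIV))"
    and prob_space_chain_law: "prob_space (chain_law Q x)"
    and emeasure_chain_law_cylinder:
      "emeasure (chain_law Q x) {\<omega>. \<forall>i\<le>n. \<omega> i = xs i} =
         (if xs 0 = x then ennreal (\<Prod>i<n. pmf (Q (xs i)) (xs (Suc i))) else 0)"
proof -
  interpret IT: Ionescu_Tulcea "chain_step Q x" "\<lambda>_. count_space UNIV :: 's measure"
    by (rule Ionescu_Tulcea_chain_step)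
  let ?M = "\<lambda>_::nat. count_space UNIV :: 's measure"
  show sets_eq: "sets (chain_law Q x) = sets (PiM UNIV ?M)"
    by (simp add: chain_law_def)
  show "prob_space (chain_law Q x)"
    unfolding chain_law_def
  proof (rule prob_space_distrD)
    show "(\<lambda>\<omega>. restrict \<omega> {}) \<in> IT.PF.lim \<rightarrow>\<^sub>M PiM {} ?M"
      by (rule measurable_restrict) simp
    show "prob_space (distr IT.PF.lim (PiM {} ?M) (\<lambda>\<omega>. restrict \<omega> {}))"
      using IT.PF.prob_space_P[of "{}"] IT.distr_lim[of "{}"] by simp
  qed
  let ?A = "\<lambda>n. {\<omega>\<in>space (PiM {0..<Suc n} ?M). \<forall>i\<le>n. \<omega> i = xs i}"
  have A: "?A n \<in> sets (PiM {0..<Suc n} ?M)" for n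
    by measurable
  have sp: "\<omega> \<in> space (PiM {0..<n} ?M) \<longleftrightarrow> \<omega> \<in> extensional {0..<n}" for \<omega> :: "nat \<Rightarrow> 's" and n
    by (auto simp: space_PiM PiE_iff)
  have eP: "emeasure (IT.eP (Suc n) \<omega>) (?A (Suc n)) =
      ennreal (pmf (Q (xs n)) (xs (Suc n))) * indicator (?A n) \<omega>"
    if \<omega>: "\<omega> \<in> space (PiM {0..<Suc n} ?M)" for n \<omega>
  proof -
    have "(\<lambda>y. fun_upd \<omega> (Suc n) y) -` ?A (Suc n) = (if \<omega> \<in> ?A n then {xs (Suc n)} else {})"
      using \<omega> unfolding mem_Collect_eq vimage_def sp by (auto simp: extensional_def le_Suc_eq)
    then show ?thesis
      using \<omega> by (subst IT.emeasure_eP[OF \<omega> A])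
        (auto simp: chain_step_def emeasure_pmf_single split: split_indicator)
  qed
  have C: "emeasure (IT.C 0 (Suc n) (\<lambda>_. undefined)) (?A n) =
    (if xs 0 = x then ennreal (\<Prod>i<n. pmf (Q (xs i)) (xs (Suc i))) else 0)" for n
  proof (induction n)
    case 0
    have u: "(\<lambda>_. undefined) \<in> space (PiM {0..<0} ?M)"
      by (simp add: sp)
    have "(\<lambda>y. fun_upd (\<lambda>_. undefined) 0 y) -` ?A 0 = {xs 0}"
      unfolding mem_Collect_eq vimage_def sp by (auto simp: extensional_def)
    then have "emeasure (IT.eP 0 (\<lambda>_. undefined)) (?A 0) = ennreal (pmf (return_pmf x) (xs 0))"
      using IT.emeasure_eP[OF u A[of 0]] by (simp add: chain_step_def emeasure_pmf_single)
    moreover have "IT.C 0 (Suc 0) (\<lambda>_. undefined) = IT.eP 0 (\<lambda>_. undefined)"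
      using bind_return[OF IT.measurable_eP u] by simp
    ultimately show ?case
      by (simp add: pmf_return del: IT.C.simps)
  next
    case (Suc n)
    have u: "(\<lambda>_. undefined) \<in> space (PiM {0..<0} ?M)"
      by (simp add: sp)
    have spC: "space (IT.C 0 (Suc n) (\<lambda>_. undefined)) = space (PiM {0..<Suc n} ?M)"
      using IT.space_C[OF u, of "Suc n"] by simp
    have setsC: "sets (IT.C 0 (Suc n) (\<lambda>_. undefined)) = sets (PiM {0..<Suc n} ?M)"
      using IT.sets_C[OF u, of "Suc n"] by simp
    have ne: "space (IT.C 0 (Suc n) (\<lambda>_. undefined)) \<noteq> {}"
      by (rule prob_space.not_empty[OF IT.prob_space_C[OF u]])
    have "emeasure (IT.C 0 (Suc (Suc n)) (\<lambda>_. undefined)) (?A (Suc n)) =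
        emeasure (IT.C 0 (Suc n) (\<lambda>_. undefined) \<bind> IT.eP (Suc n)) (?A (Suc n))"
      by simp
    also have "\<dots> = (\<integral>\<^sup>+\<omega>. emeasure (IT.eP (Suc n) \<omega>) (?A (Suc n)) \<partial>IT.C 0 (Suc n) (\<lambda>_. undefined))"
      by (rule emeasure_bind[OF ne _ A])
         (simp add: measurable_cong_sets[OF setsC refl] del: IT.C.simps)
    also have "\<dots> = (\<integral>\<^sup>+\<omega>. ennreal (pmf (Q (xs n)) (xs (Suc n))) * indicator (?A n) \<omega>
        \<partial>IT.C 0 (Suc n) (\<lambda>_. undefined))"
      by (rule nn_integral_cong, rule eP) (simp only: spC)
    also have "\<dots> = ennreal (pmf (Q (xs n)) (xs (Suc n))) *
        emeasure (IT.C 0 (Suc n) (\<lambda>_. undefined)) (?A n)"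
      by (rule nn_integral_cmult_indicator) (simp only: setsC A)
    finally show ?case
      unfolding Suc.IH by (auto simp: ennreal_mult[symmetric] prod_nonneg mult.commute simp del: IT.C.simps)
  qed
  have "{\<omega>. \<forall>i\<le>n. \<omega> i = xs i} = prod_emb UNIV ?M {0..<Suc n} (?A n)"
    by (auto simp: prod_emb_def space_PiM)
  then have "emeasure (chain_law Q x) {\<omega>. \<forall>i\<le>n. \<omega> i = xs i} =
      emeasure (IT.CI {0..<Suc n}) (?A n)"
    unfolding chain_law_def using IT.lim[OF _ A[of n]] by simp
  also have "\<dots> = emeasure (IT.C 0 (Suc n) (\<lambda>_. undefined)) (?A n)"
    using IT.emeasure_CI[of "{0..<Suc n}" "Suc n", OF _ A[of n]] prod_emb_id[of "?A n" "{0..<Suc n}" ?M]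
    by (auto simp: space_PiM simp del: IT.C.simps)
  finally show "emeasure (chain_law Q x) {\<omega>. \<forall>i\<le>n. \<omega> i = xs i} =
         (if xs 0 = x then ennreal (\<Prod>i<n. pmf (Q (xs i)) (xs (Suc i))) else 0)"
    unfolding C .
qed

definition transl_inv :: "(int \<times> int \<Rightarrow> (int \<times> int) pmf) \<Rightarrow> bool" where
  "transl_inv Q \<longleftrightarrow>
     (\<forall>u v u' v'. pmf (Q (u, v)) (u', v') = pmf (Q (0, v)) (u' - u, v'))"

text \<open>Hitting time of the horizontal axis after time \<open>0\<close>; the infimum of the empty set is \<open>\<infinity>\<close>.\<close>

definition hit_axis :: "(nat \<Rightarrow> int \<times> int) \<Rightarrow> enat" where
  "hit_axis \<omega> = Inf {enat n | n. n > 0 \<and> snd (\<omega> n) = 0}"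

definition property_F :: "(int \<times> int \<Rightarrow> (int \<times> int) pmf) \<Rightarrow> bool" where
  "property_F Q \<longleftrightarrow> (AE \<omega> in chain_law Q (0, 0). hit_axis \<omega> < \<infinity>)"

text \<open>Only meaningful when \<open>property_F Q\<close> holds: \<open>the_enat \<infinity>\<close> is arbitrary.\<close>

definition phi :: "(int \<times> int \<Rightarrow> (int \<times> int) pmf) \<Rightarrow> int measure" where
  "phi Q = distr (chain_law Q (0, 0)) (count_space UNIV) (\<lambda>\<omega>. fst (\<omega> (the_enat (hit_axis \<omega>))))"

definition successfully_coupled ::
    "(int \<times> int \<Rightarrow> (int \<times> int) pmf) \<Rightarrow> (int \<times> int \<Rightarrow> (int \<times> int) pmf) \<Rightarrow> bool" where
  "successfully_coupled Q Q0 \<longleftrightarrow>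
     (\<exists>R :: int \<times> int \<times> int \<Rightarrow> (int \<times> int \<times> int) pmf.
        (\<forall>u v w u' v'. (\<Sum>\<^sub>\<infinity>w'. pmf (R (u, v, w)) (u', v', w')) = pmf (Q0 (u, v)) (u', v')) \<and>
        (\<forall>u v w u' w'. (\<Sum>\<^sub>\<infinity>v'. pmf (R (u, v, w)) (u', v', w')) = pmf (Q (u, w)) (u', w')) \<and>
        (\<forall>u v w u' v' w'. \<bar>w\<bar> \<le> \<bar>v\<bar> + 1 \<longrightarrow> \<bar>w'\<bar> > \<bar>v'\<bar> + 1 \<longrightarrow>
           pmf (R (u, v, w)) (u', v', w') = 0))"

definition first_return_at_origin :: "(nat \<Rightarrow> int \<times> int) set" where
  "first_return_at_origin = {\<omega>. hit_axis \<omega> < \<infinity> \<and> \<omega> (the_enat (hit_axis \<omega>)) = (0, 0)}"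

definition property_C :: "real \<Rightarrow> (int \<times> int \<Rightarrow> (int \<times> int) pmf) \<Rightarrow> bool" where
  "property_C p Q \<longleftrightarrow>
     measure (chain_law Q (0, 1)) first_return_at_origin \<ge> p \<and>
     measure (chain_law Q (0, -1)) first_return_at_origin \<ge> p"

definition recurrent_process :: "'w measure \<Rightarrow> (nat \<Rightarrow> 'w \<Rightarrow> int) \<Rightarrow> bool" where
  "recurrent_process M S \<longleftrightarrow> (\<forall>u. AE \<omega> in M. infinite {n. S n \<omega> = u})"

text \<open>The random walk is realised on the infinite product space of its steps.\<close>

definition recurrent_law :: "int measure \<Rightarrow> bool" where
  "recurrent_law P \<longleftrightarrow>
     recurrent_process (PiM (UNIV :: nat set) (\<lambda>_. P)) (\<lambda>n \<omega>. \<Sum>j<n. \<omega> j)"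

text \<open>The index set \<open>{1, \<dots>, k}\<close>; for \<open>k = \<infinity>\<close> it is the set of all positive integers.\<close>

definition idx :: "enat \<Rightarrow> nat set" where
  "idx k = {i. 1 \<le> i \<and> enat i \<le> k}"

text \<open>
  The conditioning sigma-algebra at step \<open>n\<close>, i.e. the one generated by
  \<open>S 0, \<dots>, S n\<close> and \<open>I 1, \<dots>, I (n + 1)\<close>; the value \<open>I 0\<close> is never used.
\<close>

definition hist_next ::
    "'w measure \<Rightarrow> (nat \<Rightarrow> 'w \<Rightarrow> int) \<Rightarrow> (nat \<Rightarrow> 'w \<Rightarrow> nat) \<Rightarrow> nat \<Rightarrow> 'w measure" where
  "hist_next M S I n = sigma (space M)
     ({S l -` A \<inter> space M | l A. l \<le> n} \<union> {I l -` A \<inter> space M | l A. 1 \<le> l \<and> l \<le> Suc n})"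

text \<open>
  Since the increments are integer valued, that the conditional law of \<open>S (n + 1) - S n\<close> is
  \<open>P (I (n + 1))\<close> means that the conditional probabilities of all \<open>A \<subseteq> \<int>\<close> are given by it
  almost surely.
\<close>

definition CL ::
    "'w measure \<Rightarrow> enat \<Rightarrow> (nat \<Rightarrow> int measure) \<Rightarrow> (nat \<Rightarrow> 'w \<Rightarrow> int) \<Rightarrow> (nat \<Rightarrow> 'w \<Rightarrow> nat) \<Rightarrow> bool" where
  "CL M k P S I \<longleftrightarrow>
     (\<forall>n. S n \<in> M \<rightarrow>\<^sub>M count_space UNIV) \<and>
     (\<forall>n\<ge>1. I n \<in> M \<rightarrow>\<^sub>M count_space UNIV \<and> (\<forall>\<omega>\<in>space M. I n \<omega> \<in> idx k)) \<and>
     (\<forall>n A. AE \<omega> in M.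
        real_cond_exp M (hist_next M S I n) (\<lambda>\<omega>'. indicator A (S (Suc n) \<omega>' - S n \<omega>')) \<omega>
          = measure (P (I (Suc n) \<omega>)) A)"

end

theory Submission
  imports Defs
begin

text \<open>
  Recurrence of \<open>S\<close> at \<open>u\<close> means that for every \<open>n\<close> the event of avoiding \<open>u\<close> at all times after
  \<open>n\<close> is null.  For \<open>z \<noteq> u\<close> let \<open>g z\<close> be the supremum, over all \<open>n\<close> and all events \<open>E\<close> of the
  past of step \<open>n + 1\<close> on which \<open>S n = z\<close>, of the conditional probability of this avoidance given
  \<open>E\<close>, and let \<open>g u = 0\<close>.  Property (CL) yields the one-step bound
  \<open>g z \<le> sup\<^sub>i E g (z + X\<^sub>i)\<close>, where \<open>X\<^sub>i\<close> has law \<open>phi (Q i)\<close> (\<open>CL_avoid_le\<close>).  All information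
  about the process is now in this inequality, and it remains to see that it forces \<open>g = 0\<close>
  (\<open>avoidance_bound_vanishes\<close>); no process has to be built on an enlarged probability space.

  For this, \<open>g\<close> is lifted to the plane.  Let \<open>H i (z, w)\<close> be the expectation of \<open>g\<close> at the first
  return to the axis of the chain \<open>Q i\<close> started at \<open>(z, w)\<close>, with \<open>H i (z, 0) = g z\<close>, and let
  \<open>F (z, v)\<close> be the supremum of \<open>H i (z, w)\<close> over all \<open>i\<close> and all \<open>w\<close> with \<open>\<bar>w\<bar> \<le> \<bar>v\<bar> + 1\<close>.  The
  couplings preserve this relation between \<open>w\<close> and \<open>v\<close> and have \<open>Q 0\<close> as common marginal, hence \<open>F\<close>
  is subharmonic for \<open>Q 0\<close> (\<open>coupled_integral_le\<close>).  Stopping at the first return to the axis shows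
  that \<open>z \<mapsto> F (z, 0)\<close> is subharmonic for the walk with step law \<open>phi (Q 0)\<close>
  (\<open>subharmonic_le_exit\<close>), and since this walk is recurrent, \<open>F (z, 0) \<le> F (u, 0)\<close> for all \<open>z\<close>
  (\<open>recurrent_law_subharmonic\<close>).  At \<open>(u, 0)\<close> only the heights \<open>-1, 0, 1\<close> are admissible.
  Height \<open>0\<close> gives \<open>g u = 0\<close>.  From height \<open>1\<close> or \<open>-1\<close> the first return is at \<open>u\<close>, where \<open>g\<close>
  vanishes, with probability at least \<open>p\<close>, so the expectation is at most
  \<open>(1 - p) sup g \<le> (1 - p) F (u, 0)\<close>.  Thus \<open>F (u, 0) \<le> (1 - p) F (u, 0)\<close>, which gives
  \<open>F (u, 0) = 0\<close> and \<open>g = 0\<close>.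

  The argument uses that expectations under \<open>phi (Q i)\<close> are expectations at the first return, which
  requires that \<open>Q i\<close> satisfies property (F).  This follows from the same comparison with the
  probability of never returning in the place of \<open>g\<close> (\<open>coupled_property_F\<close>).
\<close>

section \<open>The Markov property of chain laws\<close>

abbreviation path_space :: "(nat \<Rightarrow> 's) measure" where
  "path_space \<equiv> PiM UNIV (\<lambda>_. count_space UNIV)"

lemma cylinder_in_path_space:
  "{\<omega>. \<forall>i\<le>n. \<omega> i = xs i} \<in> sets (path_space :: (nat \<Rightarrow> 's::countable) measure)"
proof -
  have "{\<omega> \<in> space (path_space :: (nat \<Rightarrow> 's) measure). \<forall>i\<le>n. \<omega> i = xs i} \<in> sets path_space"
    by measurable
  then show ?thesis by (simp add: space_PiM)
qed

lemma sets_path_space_cylinders: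
  "sets (path_space :: (nat \<Rightarrow> 's::countable) measure) =
     sigma_sets UNIV (insert {} {{\<omega>. \<forall>i\<le>n. \<omega> i = xs i} | n xs. True})"
  (is "_ = sigma_sets UNIV ?C")
proof
  have "{\<omega>. \<omega> j \<in> A} \<in> sigma_sets UNIV ?C" for j :: nat and A :: "'s set"
  proof -
    have "{\<omega>. \<omega> j \<in> A} = (\<Union>l\<in>{l. length l = Suc j \<and> l ! j \<in> A}. {\<omega>. \<forall>i\<le>j. \<omega> i = l ! i})"
    proof (intro equalityI subsetI)
      fix \<omega> assume "\<omega> \<in> {\<omega>. \<omega> j \<in> A}"
      then show "\<omega> \<in> (\<Union>l\<in>{l. length l = Suc j \<and> l ! j \<in> A}. {\<omega>. \<forall>i\<le>j. \<omega> i = l ! i})"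
        by (intro UN_I[of "map \<omega> [0..<Suc j]"]) (auto simp del: upt_Suc)
    qed auto
    also have "\<dots> \<in> sigma_sets UNIV ?C"
      using sigma_algebra_sigma_sets[of ?C UNIV]
      by (intro sigma_algebra.countable_UN'[of UNIV "sigma_sets UNIV ?C"])
         (auto intro!: sigma_sets.Basic)
    finally show ?thesis .
  qed
  then have "sets (path_space :: (nat \<Rightarrow> 's) measure) \<subseteq> sets (sigma UNIV ?C)"
    by (intro sets_PiM_in_sets) auto
  then show "sets (path_space :: (nat \<Rightarrow> 's) measure) \<subseteq> sigma_sets UNIV ?C"
    by simp
  show "sigma_sets UNIV ?C \<subseteq> sets (path_space :: (nat \<Rightarrow> 's) measure)"
  proof -
    have "?C \<subseteq> sets (path_space :: (nat \<Rightarrow> 's) measure)"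
      using cylinder_in_path_space by blast
    from sets.sigma_sets_subset[OF this] show ?thesis
      by (simp add: space_PiM)
  qed
qed

text \<open>
  Two cylinders are nested or disjoint, so together with the empty set they form a generator of the
  product sigma-algebra that is stable under intersection; on the countable state space the
  cylinders of length one cover path space.
\<close>
lemma path_measure_eqI:
  fixes M N :: "(nat \<Rightarrow> 's::countable) measure"
  assumes M: "prob_space M" "sets M = sets path_space"
    and N: "sets N = sets path_space"
    and eq: "\<And>n xs. emeasure M {\<omega>. \<forall>i\<le>n. \<omega> i = xs i} = emeasure N {\<omega>. \<forall>i\<le>n. \<omega> i = xs i}"
  shows "M = N"
proof -
  interpret M: prob_space M by fact
  let ?C = "insert {} {{\<omega>. \<forall>i\<le>n. \<omega> i = xs i} | n xs. True} :: (nat \<Rightarrow> 's) set set"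
  have Int: "{\<omega>. (\<forall>i\<le>n. \<omega> i = xs i) \<and> (\<forall>i\<le>m. \<omega> i = ys i)} \<in> ?C"
    for n m :: nat and xs ys :: "nat \<Rightarrow> 's"
  proof (cases "\<forall>i\<le>min n m. xs i = ys i")
    case True
    then have "{\<omega>. (\<forall>i\<le>n. \<omega> i = xs i) \<and> (\<forall>i\<le>m. \<omega> i = ys i)} =
        {\<omega>. \<forall>i\<le>max n m. \<omega> i = (if n \<le> m then ys else xs) i}"
      by (auto simp: max_def)
    then show ?thesis by blast
  next
    case False
    then have "{\<omega>. (\<forall>i\<le>n. \<omega> i = xs i) \<and> (\<forall>i\<le>m. \<omega> i = ys i)} = {}" by auto
    then show ?thesis by simp
  qed
  have stable: "Int_stable ?C"
  proof (rule Int_stableI)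
    fix A B assume "A \<in> ?C" "B \<in> ?C"
    then consider "A = {} \<or> B = {}" | n xs m ys where "A = {\<omega>. \<forall>i\<le>n. \<omega> i = xs i}" "B = {\<omega>. \<forall>i\<le>m. \<omega> i = ys i}"
      by blast
    then show "A \<inter> B \<in> ?C"
    proof cases
      case 2
      then show ?thesis using Int[of n xs m ys] by (simp only: Collect_conj_eq)
    qed auto
  qed
  have UN: "(\<Union>y. {\<omega>. \<forall>i\<le>0::nat. \<omega> i = (y :: 's)}) = UNIV"
    by auto
  show ?thesis
  proof (rule measure_eqI_generator_eq_countable[where E = ?C and \<Omega> = UNIV and
        A = "range (\<lambda>y. {\<omega>. \<forall>i\<le>0::nat. \<omega> i = (\<lambda>_. y) i})"])
    show "range (\<lambda>y. {\<omega>. \<forall>i\<le>0::nat. \<omega> i = (\<lambda>_. y) i}) \<subseteq> ?C"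
      by blast
  qed (use stable eq M N UN in \<open>auto simp: sets_path_space_cylinders M.emeasure_eq_measure\<close>)
qed

lemma AE_chain_law_start:
  fixes Q :: "'s::countable \<Rightarrow> 's pmf"
  shows "AE \<omega> in chain_law Q x. \<omega> 0 = x"
proof -
  interpret prob_space "chain_law Q x" by (rule prob_space_chain_law)
  have "emeasure (chain_law Q x) {\<omega>. \<forall>i\<le>0. \<omega> i = x} = 1"
    using emeasure_chain_law_cylinder[of Q x 0 "\<lambda>_. x"] by simp
  then have "prob {\<omega>. \<forall>i\<le>0. \<omega> i = x} = 1"
    by (simp add: emeasure_eq_measure)
  then show ?thesis
    using cylinder_in_path_space[of 0 "\<lambda>_. x"]
    by (subst (asm) prob_eq_1) (auto simp: sets_chain_law)
qed

lemma space_chain_law: "space (chain_law Q (x :: 's::countable)) = UNIV"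
  by (simp add: sets_eq_imp_space_eq[OF sets_chain_law] space_PiM)

lemma measurable_map_path:
  fixes Q :: "'s::countable \<Rightarrow> 's pmf"
  shows "(\<lambda>\<omega> n. h (\<omega> n)) \<in> chain_law Q x \<rightarrow>\<^sub>M path_space"
  unfolding measurable_cong_sets[OF sets_chain_law refl]
  by (rule measurable_PiM_single') (auto simp: space_PiM)

lemma measurable_shift:
  fixes Q :: "'s::countable \<Rightarrow> 's pmf"
  shows "(\<lambda>\<omega> n. \<omega> (Suc n)) \<in> chain_law Q x \<rightarrow>\<^sub>M path_space"
  unfolding measurable_cong_sets[OF sets_chain_law refl]
  by (rule measurable_PiM_single') (auto simp: space_PiM)

lemma measurable_chain_law_kernel:
  fixes Q :: "'s::countable \<Rightarrow> 's pmf"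
  shows "chain_law Q \<in> measure_pmf (Q x) \<rightarrow>\<^sub>M subprob_algebra path_space"
  by (simp add: measurable_pmf_measure1 space_subprob_algebra sets_chain_law
      prob_space_imp_subprob_space[OF prob_space_chain_law])

text \<open>
  The Markov property at time one.  After fixing the starting point, both sides give a cylinder
  the same product of transition probabilities.
\<close>
lemma distr_chain_law_shift:
  fixes Q :: "'s::countable \<Rightarrow> 's pmf"
  shows "distr (chain_law Q x) path_space (\<lambda>\<omega> n. \<omega> (Suc n)) = measure_pmf (Q x) \<bind> chain_law Q"
proof (rule path_measure_eqI)
  interpret prob_space "chain_law Q x" by (rule prob_space_chain_law)
  note sh = measurable_shift[of Q x]
  show "prob_space (distr (chain_law Q x) path_space (\<lambda>\<omega> n. \<omega> (Suc n)))"
    by (rule prob_space_distr[OF sh])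
  show "sets (distr (chain_law Q x) path_space (\<lambda>\<omega> n. \<omega> (Suc n))) = sets path_space"
    by simp
  note ker = measurable_chain_law_kernel[of Q x]
  show "sets (measure_pmf (Q x) \<bind> chain_law Q) = sets path_space"
    by (rule sets_bind[OF _ ]) (auto simp: sets_chain_law)
  fix n :: nat and xs
  have "emeasure (distr (chain_law Q x) path_space (\<lambda>\<omega> n. \<omega> (Suc n))) {\<omega>. \<forall>i\<le>n. \<omega> i = xs i} =
     emeasure (chain_law Q x) ((\<lambda>\<omega> n. \<omega> (Suc n)) -` {\<omega>. \<forall>i\<le>n. \<omega> i = xs i})"
    by (subst emeasure_distr[OF sh cylinder_in_path_space])
       (simp add: space_chain_law)
  also have "\<dots> = emeasure (chain_law Q x) {\<omega>. \<forall>i\<le>Suc n. \<omega> i = case_nat x xs i}"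
  proof (rule emeasure_eq_AE)
    show "AE \<omega> in chain_law Q x. \<omega> \<in> (\<lambda>\<omega> n. \<omega> (Suc n)) -` {\<omega>. \<forall>i\<le>n. \<omega> i = xs i} \<longleftrightarrow>
        \<omega> \<in> {\<omega>. \<forall>i\<le>Suc n. \<omega> i = case_nat x xs i}"
      using AE_chain_law_start by eventually_elim (auto split: nat.split simp: all_conj_distrib less_Suc_eq_le[symmetric] less_Suc_eq_0_disj)
    show "(\<lambda>\<omega> n. \<omega> (Suc n)) -` {\<omega>. \<forall>i\<le>n. \<omega> i = xs i} \<in> events"
      using measurable_sets[OF sh cylinder_in_path_space, of n xs]
      by (simp add: space_chain_law)
  qed (use cylinder_in_path_space[of "Suc n" "case_nat x xs"] in \<open>simp add: sets_chain_law\<close>)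
  also have "\<dots> = ennreal (pmf (Q x) (xs 0)) * ennreal (\<Prod>i<n. pmf (Q (xs i)) (xs (Suc i)))"
    by (subst emeasure_chain_law_cylinder)
       (auto simp: prod.lessThan_Suc_shift ennreal_mult' prod_nonneg simp del: prod.lessThan_Suc)
  also have "\<dots> = (\<integral>\<^sup>+y. ennreal (\<Prod>i<n. pmf (Q (xs i)) (xs (Suc i))) * indicator {xs 0} y \<partial>Q x)"
    by (subst nn_integral_cmult_indicator) (auto simp: emeasure_pmf_single mult.commute)
  also have "\<dots> = (\<integral>\<^sup>+y. emeasure (chain_law Q y) {\<omega>. \<forall>i\<le>n. \<omega> i = xs i} \<partial>Q x)"
    by (intro nn_integral_cong) (auto simp: emeasure_chain_law_cylinder split: split_indicator)
  also have "\<dots> = emeasure (measure_pmf (Q x) \<bind> chain_law Q) {\<omega>. \<forall>i\<le>n. \<omega> i = xs i}"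
    by (rule emeasure_bind[OF _ ker cylinder_in_path_space, symmetric]) simp
  finally show "emeasure (distr (chain_law Q x) path_space (\<lambda>\<omega> n. \<omega> (Suc n))) {\<omega>. \<forall>i\<le>n. \<omega> i = xs i} =
    emeasure (measure_pmf (Q x) \<bind> chain_law Q) {\<omega>. \<forall>i\<le>n. \<omega> i = xs i}" .
qed

lemma nn_integral_chain_law_shift:
  fixes Q :: "'s::countable \<Rightarrow> 's pmf"
  assumes [measurable]: "\<Phi> \<in> borel_measurable path_space"
  shows "(\<integral>\<^sup>+\<omega>. \<Phi> (\<lambda>n. \<omega> (Suc n)) \<partial>chain_law Q x) = (\<integral>\<^sup>+y. \<integral>\<^sup>+\<omega>. \<Phi> \<omega> \<partial>chain_law Q y \<partial>Q x)"
proof -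
  note sh = measurable_shift[of Q x]
  note ker = measurable_chain_law_kernel[of Q x]
  have "(\<integral>\<^sup>+\<omega>. \<Phi> (\<lambda>n. \<omega> (Suc n)) \<partial>chain_law Q x) =
      (\<integral>\<^sup>+\<omega>. \<Phi> \<omega> \<partial>distr (chain_law Q x) path_space (\<lambda>\<omega> n. \<omega> (Suc n)))"
    by (rule nn_integral_distr[OF sh, symmetric]) simp
  then show ?thesis
    by (simp add: distr_chain_law_shift nn_integral_bind[OF assms ker])
qed

text \<open>
  A bijection of the state space that commutes with the transition matrix transports the whole law
  of the chain; it is used for horizontal translations.
\<close>
lemma chain_law_map:
  fixes Q :: "'s::countable \<Rightarrow> 's pmf"
  assumes h: "bij h" and eq: "\<And>x. Q (h x) = map_pmf h (Q x)"
  shows "chain_law Q (h x) = distr (chain_law Q x) path_space (\<lambda>\<omega> n. h (\<omega> n))"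
proof (rule path_measure_eqI)
  show "prob_space (chain_law Q (h x))" "sets (chain_law Q (h x)) = sets path_space"
    by (simp_all add: prob_space_chain_law sets_chain_law)
  note m = measurable_map_path[of h Q x]
  fix n :: nat and xs
  have pre: "(\<lambda>\<omega> n. h (\<omega> n)) -` {\<omega>. \<forall>i\<le>n. \<omega> i = xs i} = {\<omega>. \<forall>i\<le>n. \<omega> i = inv h (xs i)}"
    using h by (auto simp: bij_inv_eq_iff)
  have "pmf (Q y) z = pmf (Q (inv h y)) (inv h z)" for y z
    using eq[of "inv h y"] h pmf_map_inj'[of h "Q (inv h y)" "inv h z"]
    by (simp add: bij_is_inj bij_is_surj surj_f_inv_f)
  then show "emeasure (chain_law Q (h x)) {\<omega>. \<forall>i\<le>n. \<omega> i = xs i} =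
      emeasure (distr (chain_law Q x) path_space (\<lambda>\<omega> n. h (\<omega> n))) {\<omega>. \<forall>i\<le>n. \<omega> i = xs i}"
    using bij_inv_eq_iff[OF h, of x "xs 0"] unfolding emeasure_distr[OF m cylinder_in_path_space] pre
    by (simp add: space_chain_law emeasure_chain_law_cylinder
        eq_commute[of _ x] eq_commute[of _ "xs 0"])
qed simp

section \<open>The first return to the axis\<close>

text \<open>
  A functional that vanishes on paths which never meet the axis.  Thus \<open>exit_mean Q f x\<close> below is
  the expectation of \<open>f\<close> at the first return to the axis, restricted to the event that there is one.
\<close>
definition axis_pay :: "(int \<times> int \<Rightarrow> ennreal) \<Rightarrow> (nat \<Rightarrow> int \<times> int) \<Rightarrow> ennreal" where
  "axis_pay f \<omega> = (if hit_axis \<omega> < \<infinity> then f (\<omega> (the_enat (hit_axis \<omega>))) else 0)"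

definition exit_mean :: "(int \<times> int \<Rightarrow> (int \<times> int) pmf) \<Rightarrow> (int \<times> int \<Rightarrow> ennreal) \<Rightarrow> int \<times> int \<Rightarrow> ennreal" where
  "exit_mean Q f x = (\<integral>\<^sup>+\<omega>. axis_pay f \<omega> \<partial>chain_law Q x)"

definition stay :: "(int \<times> int \<Rightarrow> (int \<times> int) pmf) \<Rightarrow> nat \<Rightarrow> int \<times> int \<Rightarrow> ennreal" where
  "stay Q n x = emeasure (chain_law Q x) {\<omega>. enat n < hit_axis \<omega>}"

definition escape :: "(int \<times> int \<Rightarrow> (int \<times> int) pmf) \<Rightarrow> int \<times> int \<Rightarrow> ennreal" where
  "escape Q x = emeasure (chain_law Q x) {\<omega>. hit_axis \<omega> = \<infinity>}"

lemma hit_axis_eq_Least: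
  "hit_axis \<omega> = (if \<exists>n>0. snd (\<omega> n) = 0 then enat (LEAST n. n > 0 \<and> snd (\<omega> n) = 0) else \<infinity>)"
proof (cases "\<exists>n>0. snd (\<omega> n) = 0")
  case True
  then obtain n where "n > 0 \<and> snd (\<omega> n) = 0" by blast
  from LeastI[of "\<lambda>n. n > 0 \<and> snd (\<omega> n) = 0", OF this]
  have "hit_axis \<omega> = enat (LEAST n. n > 0 \<and> snd (\<omega> n) = 0)"
    unfolding hit_axis_def
    by (intro antisym Inf_lower Inf_greatest) (auto intro: Least_le)
  then show ?thesis using True by simp
next
  case False
  then have "{enat n |n. n > 0 \<and> snd (\<omega> n) = 0} = {}" by blast
  then show ?thesis using False by (simp only: hit_axis_def if_False) (simp add: Inf_enat_def)
qed

text \<open>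
  The return time is \<open>1\<close>, or one more than that of the shifted path.  All one-step equations of
  this section come from combining this with the Markov property.
\<close>
lemma hit_axis_rec:
  "hit_axis \<omega> = (if snd (\<omega> 1) = 0 then 1 else eSuc (hit_axis (\<lambda>n. \<omega> (Suc n))))"
proof (cases "snd (\<omega> 1) = 0")
  case True
  then have "(LEAST n. n > 0 \<and> snd (\<omega> n) = 0) = 1"
    by (intro Least_equality) auto
  then show ?thesis using True by (auto simp: hit_axis_eq_Least one_enat_def)
next
  case False
  have ex: "(\<exists>n>0. snd (\<omega> n) = 0) \<longleftrightarrow> (\<exists>n>0. snd (\<omega> (Suc n)) = 0)"
    using False by (metis One_nat_def Suc_pred less_Suc_eq_0_disj not_gr_zero zero_less_Suc)
  show ?thesis
  proof (cases "\<exists>n>0. snd (\<omega> n) = 0")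
    case True
    then obtain n where "n > 0 \<and> snd (\<omega> n) = 0" by blast
    from Least_Suc[of "\<lambda>n. n > 0 \<and> snd (\<omega> n) = 0", OF this]
    have "(LEAST n. n > 0 \<and> snd (\<omega> n) = 0) = Suc (LEAST m. snd (\<omega> (Suc m)) = 0)"
      by simp
    also have "(\<lambda>m. snd (\<omega> (Suc m)) = 0) = (\<lambda>m. m > 0 \<and> snd (\<omega> (Suc m)) = 0)"
      using False by (auto simp: fun_eq_iff intro: gr0I)
    finally show ?thesis using True False ex by (simp add: hit_axis_eq_Least eSuc_enat)
  next
    case no: False
    with ex have "\<not> (\<exists>n>0. snd (\<omega> (Suc n)) = 0)" by simp
    with no False show ?thesis
      by (simp only: hit_axis_eq_Least[of \<omega>] hit_axis_eq_Least[of "\<lambda>n. \<omega> (Suc n)"] if_False eSuc_infinity)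
  qed
qed

lemma axis_pay_rec:
  "axis_pay f \<omega> = (if snd (\<omega> 1) = 0 then f (\<omega> 1) else axis_pay f (\<lambda>n. \<omega> (Suc n)))"
proof (cases "hit_axis (\<lambda>n. \<omega> (Suc n))")
  case (enat m)
  then show ?thesis
    using hit_axis_rec[of \<omega>] by (auto simp: axis_pay_def one_enat_def eSuc_enat)
qed (use hit_axis_rec[of \<omega>] in \<open>auto simp: axis_pay_def one_enat_def\<close>)

lemma measurable_coordinate:
  assumes "f \<in> UNIV \<rightarrow> space N"
  shows "(\<lambda>\<omega>. f (\<omega> n)) \<in> path_space \<rightarrow>\<^sub>M N"
  using measurable_compose[OF measurable_component_singleton[of n UNIV "\<lambda>_. count_space UNIV"], of f N]
    assms by simp

lemma measurable_hit_axis: "hit_axis \<in> path_space \<rightarrow>\<^sub>M count_space UNIV"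
proof -
  have P: "Measurable.pred path_space (\<lambda>\<omega> :: nat \<Rightarrow> int \<times> int. n > 0 \<and> snd (\<omega> n) = 0)" for n
    by (rule measurable_coordinate[of "\<lambda>y. n > 0 \<and> snd y = 0"]) simp
  have L: "(\<lambda>\<omega> :: nat \<Rightarrow> int \<times> int. enat (LEAST n. n > 0 \<and> snd (\<omega> n) = 0)) \<in> path_space \<rightarrow>\<^sub>M count_space UNIV"
    by (rule measurable_compose[OF measurable_Least[OF P]]) simp
  have "Measurable.pred path_space (\<lambda>\<omega> :: nat \<Rightarrow> int \<times> int. \<exists>n>0. snd (\<omega> n) = 0)"
    by (rule pred_intros_countable(2)[OF P])
  then have "{\<omega> \<in> space path_space. \<exists>n>0. snd (\<omega> n :: int \<times> int) = 0} \<in> sets path_space"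
    by (simp only: pred_def)
  moreover have "(\<lambda>_. \<infinity>) \<in> path_space \<rightarrow>\<^sub>M count_space (UNIV :: enat set)"
    by (rule measurable_const) simp
  ultimately have "(\<lambda>\<omega>. if \<exists>n>0. snd (\<omega> n) = 0 then enat (LEAST n. n > 0 \<and> snd (\<omega> n :: int \<times> int) = 0) else \<infinity>)
      \<in> path_space \<rightarrow>\<^sub>M count_space UNIV"
    by (intro measurable_If[OF L])
  then show ?thesis
    unfolding hit_axis_eq_Least[symmetric] .
qed

lemma measurable_of_hit_axis: "(\<lambda>\<omega>. f (hit_axis \<omega>)) \<in> path_space \<rightarrow>\<^sub>M count_space UNIV"
  by (rule measurable_compose[OF measurable_hit_axis]) simp

lemma measurable_axis_pay: "axis_pay f \<in> borel_measurable path_space"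
proof -
  have "(\<lambda>\<omega>. f (\<omega> (the_enat (hit_axis \<omega>)))) \<in> borel_measurable path_space"
    by (rule measurable_compose_countable[where f = "\<lambda>n \<omega>. f (\<omega> n)" and g = "\<lambda>\<omega>. the_enat (hit_axis \<omega>)"])
       (simp_all only: measurable_of_hit_axis, rule measurable_coordinate, simp)
  then show ?thesis
    unfolding axis_pay_def[abs_def] using measurable_of_hit_axis[of "\<lambda>t. t < \<infinity>"]
    by (intro measurable_If measurable_const) (simp_all only: pred_def space_borel UNIV_I)
qed

text \<open>
  A functional that stops at time one when the axis is hit there, and otherwise restarts from the
  shifted path, is averaged by one step of the transition matrix.
\<close>
lemma nn_integral_chain_law_first_step:
  assumes [measurable]: "\<Phi> \<in> borel_measurable path_space"
  shows "(\<integral>\<^sup>+\<omega>. (if snd (\<omega> 1) = 0 then f (\<omega> 1) else \<Phi> (\<lambda>n. \<omega> (Suc n))) \<partial>chain_law Q x) =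
    (\<integral>\<^sup>+y. (if snd (y :: int \<times> int) = 0 then f y else \<integral>\<^sup>+\<omega>. \<Phi> \<omega> \<partial>chain_law Q y) \<partial>Q x)"
proof -
  have "(\<lambda>\<omega>. f (\<omega> 0)) \<in> borel_measurable path_space"
    by (rule measurable_coordinate) simp
  moreover have "{\<omega> \<in> space path_space. snd (\<omega> 0 :: int \<times> int) = 0} \<in> sets path_space"
    using measurable_coordinate[of "\<lambda>y. snd y = 0" "count_space UNIV" 0] by (simp only: pred_def) simp
  ultimately have meas: "(\<lambda>\<omega>. if snd (\<omega> 0) = 0 then f (\<omega> 0) else \<Phi> \<omega>) \<in> borel_measurable path_space"
    by (rule measurable_If[OF _ assms])
  have "(\<integral>\<^sup>+\<omega>. (if snd (\<omega> 1) = 0 then f (\<omega> 1) else \<Phi> (\<lambda>n. \<omega> (Suc n))) \<partial>chain_law Q x) =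
     (\<integral>\<^sup>+y. \<integral>\<^sup>+\<omega>. (if snd (\<omega> 0) = 0 then f (\<omega> 0) else \<Phi> \<omega>) \<partial>chain_law Q y \<partial>Q x)"
    unfolding One_nat_def
    by (rule nn_integral_chain_law_shift[of "\<lambda>\<omega>. if snd (\<omega> 0) = 0 then f (\<omega> 0) else \<Phi> \<omega>" Q x])
       (rule meas)
  also have "\<dots> = (\<integral>\<^sup>+y. \<integral>\<^sup>+\<omega>. (if snd y = 0 then f y else \<Phi> \<omega>) \<partial>chain_law Q y \<partial>Q x)"
    by (rule nn_integral_cong, rule nn_integral_cong_AE, rule AE_mp[OF AE_chain_law_start]) auto
  also have "\<dots> = (\<integral>\<^sup>+y. (if snd y = 0 then f y else \<integral>\<^sup>+\<omega>. \<Phi> \<omega> \<partial>chain_law Q y) \<partial>Q x)"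
    by (intro nn_integral_cong) (auto simp: prob_space.emeasure_space_1[OF prob_space_chain_law])
  finally show ?thesis .
qed

lemma exit_mean_step:
  "exit_mean Q f x = (\<integral>\<^sup>+y. (if snd y = 0 then f y else exit_mean Q f y) \<partial>Q x)"
proof -
  have "exit_mean Q f x =
      (\<integral>\<^sup>+\<omega>. (if snd (\<omega> 1) = 0 then f (\<omega> 1) else axis_pay f (\<lambda>n. \<omega> (Suc n))) \<partial>chain_law Q x)"
    unfolding exit_mean_def by (intro nn_integral_cong axis_pay_rec)
  then show ?thesis
    unfolding exit_mean_def nn_integral_chain_law_first_step[OF measurable_axis_pay] .
qed

lemma hit_axis_sets: "{\<omega>. P (hit_axis \<omega>)} \<in> sets (chain_law Q x)"
proof -
  have "{\<omega> \<in> space path_space. P (hit_axis \<omega>)} \<in> sets path_space"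
    using measurable_of_hit_axis[of P] by (simp add: pred_def)
  then show ?thesis by (simp add: sets_chain_law space_PiM)
qed

lemma borel_measurable_of_hit_axis: "(\<lambda>\<omega>. f (hit_axis \<omega>)) \<in> borel_measurable path_space"
  by (rule measurable_compose[OF measurable_hit_axis]) simp

lemma stay_0: "stay Q 0 x = 1"
proof -
  have "0 < hit_axis \<omega>" for \<omega>
    by (subst hit_axis_rec) (auto simp: eSuc_def zero_enat_def one_enat_def split: enat.split)
  then show ?thesis
    using prob_space.emeasure_space_1[OF prob_space_chain_law[of Q x]]
    by (simp add: stay_def space_chain_law enat_0)
qed

lemma stay_Suc:
  "stay Q (Suc n) x = (\<integral>\<^sup>+y. (if snd y = 0 then 0 else stay Q n y) \<partial>Q x)"
proof -
  have *: "stay Q n x = (\<integral>\<^sup>+\<omega>. of_bool (enat n < hit_axis \<omega>) \<partial>chain_law Q x)" for n x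
    using nn_integral_indicator[OF hit_axis_sets[of "\<lambda>t. enat n < t" Q x]]
    by (simp add: stay_def indicator_def[abs_def])
  have "of_bool (enat (Suc n) < hit_axis \<omega>) =
      (if snd (\<omega> 1) = 0 then 0 else of_bool (enat n < hit_axis (\<lambda>n. \<omega> (Suc n))) :: ennreal)" for \<omega>
    by (subst hit_axis_rec) (auto simp: one_enat_def eSuc_enat[symmetric])
  then show ?thesis
    unfolding * by simp (rule nn_integral_chain_law_first_step[unfolded One_nat_def], rule borel_measurable_of_hit_axis)
qed

lemma escape_eq_nn_integral:
  "escape Q x = (\<integral>\<^sup>+\<omega>. of_bool (hit_axis \<omega> = \<infinity>) \<partial>chain_law Q x)"
  using nn_integral_indicator[OF hit_axis_sets[of "\<lambda>t. t = \<infinity>" Q x]]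
  by (simp add: escape_def indicator_def[abs_def])

lemma escape_step:
  "escape Q x = (\<integral>\<^sup>+y. (if snd y = 0 then 0 else escape Q y) \<partial>Q x)"
proof -
  have "of_bool (hit_axis \<omega> = \<infinity>) =
      (if snd (\<omega> 1) = 0 then 0 else of_bool (hit_axis (\<lambda>n. \<omega> (Suc n)) = \<infinity>) :: ennreal)" for \<omega>
    by (subst hit_axis_rec) (auto simp: one_enat_def eSuc_def split: enat.splits)
  then show ?thesis
    unfolding escape_eq_nn_integral by simp (rule nn_integral_chain_law_first_step[unfolded One_nat_def], rule borel_measurable_of_hit_axis)
qed

lemma stay_LIMSEQ_escape: "(\<lambda>n. stay Q n x) \<longlonglongrightarrow> escape Q x"
proof -
  interpret prob_space "chain_law Q x" by (rule prob_space_chain_law)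
  have "(\<Inter>n. {\<omega>. enat n < hit_axis \<omega>}) = {\<omega>. hit_axis \<omega> = \<infinity>}"
  proof (intro equalityI subsetI)
    fix \<omega> assume "\<omega> \<in> (\<Inter>n. {\<omega>. enat n < hit_axis \<omega>})"
    then have "enat (the_enat (hit_axis \<omega>)) < hit_axis \<omega>" by blast
    then show "\<omega> \<in> {\<omega>. hit_axis \<omega> = \<infinity>}" by (cases "hit_axis \<omega>") auto
  qed auto
  moreover have "decseq (\<lambda>n. {\<omega>. enat n < hit_axis \<omega>})"
    by (auto simp: decseq_def intro: le_less_trans[rotated])
  ultimately show ?thesis
    using Lim_emeasure_decseq[of "\<lambda>n. {\<omega>. enat n < hit_axis \<omega>}" "chain_law Q x"]
    by (simp add: stay_def escape_def hit_axis_sets image_subset_iff)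
qed

text \<open>
  Optional stopping at the first return: up to time \<open>n\<close> the value of \<open>F\<close> is passed on by the
  subharmonic inequality, and the paths that have not returned by then contribute at most their
  probability.
\<close>
lemma subharmonic_le_exit:
  fixes Q :: "int \<times> int \<Rightarrow> (int \<times> int) pmf"
  assumes F1: "\<And>x. F x \<le> 1" and sub: "\<And>x. F x \<le> (\<integral>\<^sup>+y. F y \<partial>Q x)"
  shows "F x \<le> exit_mean Q F x + escape Q x"
proof -
  have "F x \<le> exit_mean Q F x + stay Q n x" for n
  proof (induction n arbitrary: x)
    case 0
    show ?case using F1[of x] by (simp add: stay_0 add_increasing)
  next
    case (Suc n)
    have "F x \<le> (\<integral>\<^sup>+y. F y \<partial>Q x)" by (rule sub)
    also have "\<dots> \<le> (\<integral>\<^sup>+y. (if snd y = 0 then F y else exit_mean Q F y) +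
        (if snd y = 0 then 0 else stay Q n y) \<partial>Q x)"
      using Suc by (intro nn_integral_mono) auto
    also have "\<dots> = exit_mean Q F x + stay Q (Suc n) x"
      by (subst nn_integral_add) (auto simp: exit_mean_step[symmetric] stay_Suc)
    finally show ?case .
  qed
  then show ?thesis
    by (intro LIMSEQ_le_const[OF tendsto_add[OF tendsto_const stay_LIMSEQ_escape]]) auto
qed

section \<open>Translation invariance and the return law\<close>

definition horizontal_shift :: "int \<Rightarrow> int \<times> int \<Rightarrow> int \<times> int" where
  "horizontal_shift z x = (fst x + z, snd x)"

lemma hit_axis_horizontal_shift: "hit_axis (\<lambda>n. horizontal_shift z (\<omega> n)) = hit_axis \<omega>"
  by (simp add: hit_axis_def horizontal_shift_def)

lemma axis_pay_horizontal_shift: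
  "axis_pay f (\<lambda>n. horizontal_shift z (\<omega> n)) = axis_pay (\<lambda>y. f (horizontal_shift z y)) \<omega>"
  by (simp add: axis_pay_def hit_axis_horizontal_shift)

lemma nn_integral_chain_law_horizontal_shift:
  assumes "transl_inv Q" and m: "\<Phi> \<in> borel_measurable path_space"
  shows "(\<integral>\<^sup>+\<omega>. \<Phi> \<omega> \<partial>chain_law Q (horizontal_shift z x)) =
    (\<integral>\<^sup>+\<omega>. \<Phi> (\<lambda>n. horizontal_shift z (\<omega> n)) \<partial>chain_law Q x)"
proof -
  have bij: "bij (horizontal_shift z)"
    by (rule bij_betw_byWitness[where f' = "horizontal_shift (- z)"]) (auto simp: horizontal_shift_def)
  have eq: "Q (horizontal_shift z x) = map_pmf (horizontal_shift z) (Q x)" for x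
  proof (rule pmf_eqI)
    fix y
    have "pmf (map_pmf (horizontal_shift z) (Q x)) (horizontal_shift z (fst y - z, snd y)) =
        pmf (Q x) (fst y - z, snd y)"
      by (rule pmf_map_inj'[OF bij_is_inj[OF bij]])
    also have "\<dots> = pmf (Q (0, snd x)) (fst y - z - fst x, snd y)"
      using assms(1) by (metis transl_inv_def prod.collapse)
    also have "\<dots> = pmf (Q (fst x + z, snd x)) (fst y, snd y)"
      using assms(1) unfolding transl_inv_def by (metis add.commute diff_diff_eq)
    finally show "pmf (Q (horizontal_shift z x)) y = pmf (map_pmf (horizontal_shift z) (Q x)) y"
      by (simp add: horizontal_shift_def)
  qed
  show ?thesis
    unfolding chain_law_map[where h = "horizontal_shift z" and Q = Q, OF bij eq] by (rule nn_integral_distr[OF measurable_map_path]) (simp add: m)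
qed

lemma exit_mean_horizontal_shift:
  assumes "transl_inv Q"
  shows "exit_mean Q f (horizontal_shift z x) = exit_mean Q (\<lambda>y. f (horizontal_shift z y)) x"
  unfolding exit_mean_def nn_integral_chain_law_horizontal_shift[OF assms measurable_axis_pay]
    axis_pay_horizontal_shift ..

lemma escape_horizontal_shift:
  assumes "transl_inv Q"
  shows "escape Q (horizontal_shift z x) = escape Q x"
  unfolding escape_eq_nn_integral
  by (subst nn_integral_chain_law_horizontal_shift[OF assms borel_measurable_of_hit_axis])
     (simp add: hit_axis_horizontal_shift)

lemma snd_hit_axis: "hit_axis \<omega> < \<infinity> \<Longrightarrow> snd (\<omega> (the_enat (hit_axis \<omega>))) = 0"
  using LeastI_ex[of "\<lambda>n. n > 0 \<and> snd (\<omega> n) = 0"]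
  by (cases "\<exists>n>0. snd (\<omega> n) = 0") (simp_all add: hit_axis_eq_Least)

lemma exit_mean_le:
  assumes "\<And>u. f (u, 0) \<le> c"
  shows "exit_mean Q f x \<le> c"
proof -
  interpret prob_space "chain_law Q x" by (rule prob_space_chain_law)
  have "f (\<omega> (the_enat (hit_axis \<omega>))) \<le> c" if "hit_axis \<omega> < \<infinity>" for \<omega>
    using snd_hit_axis[OF that] assms by (metis prod.collapse)
  then have "exit_mean Q f x \<le> (\<integral>\<^sup>+\<omega>. c \<partial>chain_law Q x)"
    unfolding exit_mean_def by (intro nn_integral_mono) (simp add: axis_pay_def)
  then show ?thesis by (simp add: emeasure_space_1)
qed

lemma property_F_iff_escape: "property_F Q \<longleftrightarrow> escape Q (0, 0) = 0"
proof -
  have "property_F Q \<longleftrightarrow> (AE \<omega> in chain_law Q (0, 0). \<not> hit_axis \<omega> = \<infinity>)"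
    by (simp add: property_F_def)
  also have "\<dots> \<longleftrightarrow> emeasure (chain_law Q (0, 0)) {\<omega> \<in> space (chain_law Q (0, 0)). hit_axis \<omega> = \<infinity>} = 0"
    using hit_axis_sets[of "\<lambda>t. t = \<infinity>" Q "(0, 0)"]
    by (subst AE_iff_measurable[OF _ refl])
       (simp_all add: space_chain_law)
  finally show ?thesis
    by (simp add: escape_def space_chain_law)
qed

lemma
  fixes Q :: "int \<times> int \<Rightarrow> (int \<times> int) pmf"
  shows prob_space_phi: "prob_space (phi Q)"
    and nn_integral_phi: "property_F Q \<Longrightarrow> (\<integral>\<^sup>+x. f x \<partial>phi Q) = exit_mean Q (\<lambda>y. f (fst y)) (0, 0)"
proof -
  have "(\<lambda>\<omega> :: nat \<Rightarrow> int \<times> int. fst (\<omega> (the_enat (hit_axis \<omega>)))) \<in> path_space \<rightarrow>\<^sub>M count_space UNIV"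
    by (rule measurable_compose_countable[where f = "\<lambda>n \<omega>. fst (\<omega> n)" and g = "\<lambda>\<omega>. the_enat (hit_axis \<omega>)"])
       (simp_all only: measurable_of_hit_axis, rule measurable_coordinate, simp)
  then have m: "(\<lambda>\<omega>. fst (\<omega> (the_enat (hit_axis \<omega>)))) \<in> chain_law Q (0, 0) \<rightarrow>\<^sub>M count_space UNIV"
    unfolding measurable_cong_sets[OF sets_chain_law refl] .
  show "prob_space (phi Q)"
    unfolding phi_def by (rule prob_space.prob_space_distr[OF prob_space_chain_law m])
  assume "property_F Q"
  then have "AE \<omega> in chain_law Q (0, 0). f (fst (\<omega> (the_enat (hit_axis \<omega>)))) = axis_pay (\<lambda>y. f (fst y)) \<omega>"
    unfolding property_F_def by eventually_elim (simp add: axis_pay_def)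
  then have "(\<integral>\<^sup>+\<omega>. f (fst (\<omega> (the_enat (hit_axis \<omega>)))) \<partial>chain_law Q (0, 0)) = exit_mean Q (\<lambda>y. f (fst y)) (0, 0)"
    unfolding exit_mean_def by (rule nn_integral_cong_AE)
  then show "(\<integral>\<^sup>+x. f x \<partial>phi Q) = exit_mean Q (\<lambda>y. f (fst y)) (0, 0)"
    unfolding phi_def by (subst nn_integral_distr[OF m]) simp_all
qed

text \<open>
  Property (F) is essential: paths that never return are dropped by \<open>exit_mean\<close> but would
  contribute to \<open>phi\<close> through the arbitrary value of \<open>the_enat \<infinity>\<close>.
\<close>
lemma exit_mean_axis_eq_phi:
  assumes "transl_inv Q" "property_F Q"
  shows "exit_mean Q f (z, 0) = (\<integral>\<^sup>+x. f (z + x, 0) \<partial>phi Q)"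
proof -
  have "exit_mean Q f (z, 0) = exit_mean Q (\<lambda>y. f (horizontal_shift z y)) (0, 0)"
    using exit_mean_horizontal_shift[OF assms(1), of f z "(0, 0)"] by (simp add: horizontal_shift_def)
  also have "\<dots> = exit_mean Q (\<lambda>y. f (z + fst y, 0)) (0, 0)"
    unfolding exit_mean_def axis_pay_def horizontal_shift_def
    by (intro nn_integral_cong) (auto simp: snd_hit_axis add.commute)
  finally show ?thesis by (simp add: nn_integral_phi[OF assms(2)])
qed

section \<open>Comparison of coupled chains\<close>

text \<open>
  Expressing the marginals as image laws, not as infinite sums of entries, makes integrals over a
  marginal into integrals over the coupling.
\<close>
lemma successfully_coupled_coupling:
  assumes "successfully_coupled Q Q0"
  obtains R where
    "\<And>u v w. map_pmf (\<lambda>(u', v', w'). (u', v')) (R (u, v, w)) = Q0 (u, v)"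
    "\<And>u v w. map_pmf (\<lambda>(u', v', w'). (u', w')) (R (u, v, w)) = Q (u, w)"
    "\<And>u v w u' v' w'. \<bar>w\<bar> \<le> \<bar>v\<bar> + 1 \<Longrightarrow> (u', v', w') \<in> set_pmf (R (u, v, w)) \<Longrightarrow> \<bar>w'\<bar> \<le> \<bar>v'\<bar> + 1"
proof -
  from assms obtain R where
    R0: "\<And>u v w u' v'. (\<Sum>\<^sub>\<infinity>w'. pmf (R (u, v, w)) (u', v', w')) = pmf (Q0 (u, v)) (u', v')" and
    R1: "\<And>u v w u' w'. (\<Sum>\<^sub>\<infinity>v'. pmf (R (u, v, w)) (u', v', w')) = pmf (Q (u, w)) (u', w')" and
    R2: "\<And>u v w u' v' w'. \<bar>w\<bar> \<le> \<bar>v\<bar> + 1 \<Longrightarrow> \<bar>w'\<bar> > \<bar>v'\<bar> + 1 \<Longrightarrow> pmf (R (u, v, w)) (u', v', w') = 0"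
    unfolding successfully_coupled_def by blast
  have sum: "measure_pmf.prob r (range h) = (\<Sum>\<^sub>\<infinity>t. pmf r (h t))"
    if "inj h" for r :: "(int \<times> int \<times> int) pmf" and h :: "int \<Rightarrow> _"
    using that by (simp add: measure_pmf_conv_infsetsum infsetsum_infsum pmf_abs_summable infsum_reindex o_def)
  show thesis
  proof
    fix u v w :: int
    show "map_pmf (\<lambda>(u', v', w'). (u', v')) (R (u, v, w)) = Q0 (u, v)"
    proof (rule pmf_eqI)
      fix y :: "int \<times> int"
      have "(\<lambda>(u', v', w' :: int). (u', v')) -` {y} = range (\<lambda>w'. (fst y, snd y, w'))" by auto
      then show "pmf (map_pmf (\<lambda>(u', v', w'). (u', v')) (R (u, v, w))) y = pmf (Q0 (u, v)) y"
        using sum[of "\<lambda>w'. (fst y, snd y, w')" "R (u, v, w)"]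
        by (simp add: pmf_map inj_on_def R0)
    qed
    show "map_pmf (\<lambda>(u', v', w'). (u', w')) (R (u, v, w)) = Q (u, w)"
    proof (rule pmf_eqI)
      fix y :: "int \<times> int"
      have "(\<lambda>(u', v' :: int, w'). (u', w')) -` {y} = range (\<lambda>v'. (fst y, v', snd y))" by auto
      then show "pmf (map_pmf (\<lambda>(u', v', w'). (u', w')) (R (u, v, w))) y = pmf (Q (u, w)) y"
        using sum[of "\<lambda>v'. (fst y, v', snd y)" "R (u, v, w)"]
        by (simp add: pmf_map inj_on_def R1)
    qed
    fix u' v' w'
    assume "\<bar>w\<bar> \<le> \<bar>v\<bar> + 1" "(u', v', w') \<in> set_pmf (R (u, v, w))"
    then show "\<bar>w'\<bar> \<le> \<bar>v'\<bar> + 1"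
      using R2[of w v v' w' u u'] by (force simp: set_pmf_iff)
  qed
qed

text \<open>
  The coupling keeps the \<open>U\<close>-coordinates equal and never leaves the region \<open>\<bar>w\<bar> \<le> \<bar>v\<bar> + 1\<close>, so a
  pointwise inequality on that region survives one step.  Suprema over all admissible \<open>w\<close> therefore
  produce subharmonic functions of the chain with matrix \<open>Q0\<close>.
\<close>
lemma coupled_integral_le:
  assumes "successfully_coupled Q Q0" and wv: "\<bar>w\<bar> \<le> \<bar>v\<bar> + 1"
    and le: "\<And>z' v' w'. \<bar>w'\<bar> \<le> \<bar>v'\<bar> + 1 \<Longrightarrow> f (z', w') \<le> F (z', v')"
  shows "(\<integral>\<^sup>+y. f y \<partial>Q (z, w)) \<le> (\<integral>\<^sup>+y. F y \<partial>Q0 (z, v))"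
proof -
  obtain R where R:
    "\<And>u v w. map_pmf (\<lambda>(u', v', w'). (u', v')) (R (u, v, w)) = Q0 (u, v)"
    "\<And>u v w. map_pmf (\<lambda>(u', v', w'). (u', w')) (R (u, v, w)) = Q (u, w)"
    "\<And>u v w u' v' w'. \<bar>w\<bar> \<le> \<bar>v\<bar> + 1 \<Longrightarrow> (u', v', w') \<in> set_pmf (R (u, v, w)) \<Longrightarrow> \<bar>w'\<bar> \<le> \<bar>v'\<bar> + 1"
    using successfully_coupled_coupling[OF assms(1)] by metis
  have "(\<integral>\<^sup>+y. f y \<partial>Q (z, w)) = (\<integral>\<^sup>+(z', v', w'). f (z', w') \<partial>R (z, v, w))"
    unfolding R(2)[of z v w, symmetric] nn_integral_map_pmf by (simp add: case_prod_unfold)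
  also have "\<dots> \<le> (\<integral>\<^sup>+(z', v', w'). F (z', v') \<partial>R (z, v, w))"
    using R(3)[OF wv] le by (intro nn_integral_mono_AE) (auto simp: AE_measure_pmf_iff)
  also have "\<dots> = (\<integral>\<^sup>+y. F y \<partial>Q0 (z, v))"
    unfolding R(1)[of z v w, symmetric] nn_integral_map_pmf by (simp add: case_prod_unfold)
  finally show ?thesis .
qed

lemma coupled_successor:
  assumes "successfully_coupled Q Q0" and wv: "\<bar>w\<bar> \<le> \<bar>v\<bar> + 1"
    and "(z', w') \<in> set_pmf (Q (z, w))"
  obtains v' where "(z', v') \<in> set_pmf (Q0 (z, v))" "\<bar>w'\<bar> \<le> \<bar>v'\<bar> + 1"
proof -
  obtain R where R:
    "\<And>u v w. map_pmf (\<lambda>(u', v', w'). (u', v')) (R (u, v, w)) = Q0 (u, v)"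
    "\<And>u v w. map_pmf (\<lambda>(u', v', w'). (u', w')) (R (u, v, w)) = Q (u, w)"
    "\<And>u v w u' v' w'. \<bar>w\<bar> \<le> \<bar>v\<bar> + 1 \<Longrightarrow> (u', v', w') \<in> set_pmf (R (u, v, w)) \<Longrightarrow> \<bar>w'\<bar> \<le> \<bar>v'\<bar> + 1"
    using successfully_coupled_coupling[OF assms(1)] by metis
  from assms(3) obtain v' where v': "(z', v', w') \<in> set_pmf (R (z, v, w))"
    unfolding R(2)[of z v w, symmetric] by auto
  show thesis
  proof
    show "(z', v') \<in> set_pmf (Q0 (z, v))"
      unfolding R(1)[of z v w, symmetric] using v' by force
    show "\<bar>w'\<bar> \<le> \<bar>v'\<bar> + 1" using R(3)[OF wv v'] .
  qed
qed

section \<open>Returns to the axis under property C(p)\<close>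

lemma ennreal_contraction_zero:
  assumes "c \<le> (1 - ennreal p) * c" "c < top" "p > 0"
  shows "c = 0"
proof (rule ccontr)
  assume "c \<noteq> 0"
  have "1 - ennreal p < 1"
    using \<open>p > 0\<close> ennreal_minus[of p 1] by (simp add: ennreal_less_one_iff)
  then have "(1 - ennreal p) * c < 1 * c"
    using \<open>c \<noteq> 0\<close> assms(2) by (intro ennreal_mult_strict_right_mono) (auto simp: zero_less_iff_neq_zero)
  with assms(1) show False by simp
qed

lemma first_return_sets: "first_return_at_origin \<in> sets (chain_law Q x)"
proof -
  have "first_return_at_origin = {\<omega> \<in> space path_space. axis_pay (indicator {(0, 0)}) \<omega> \<noteq> 0}"
    by (auto simp: first_return_at_origin_def axis_pay_def space_PiM split: split_indicator)
  also have "\<dots> \<in> sets path_space"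
    by (rule borel_measurable_neq[OF measurable_axis_pay]) simp
  finally show ?thesis by (simp add: sets_chain_law)
qed

lemma first_return_compl_sets: "- first_return_at_origin \<in> sets (chain_law Q x)"
  using sets.compl_sets[OF first_return_sets, of Q x]
  by (simp add: Compl_eq_Diff_UNIV space_chain_law)

lemma property_C_miss:
  assumes "property_C p Q" "\<bar>s\<bar> = 1"
  shows "emeasure (chain_law Q (0, s)) (- first_return_at_origin) \<le> 1 - ennreal p"
proof -
  interpret prob_space "chain_law Q (0, s)" by (rule prob_space_chain_law)
  have "p \<le> prob first_return_at_origin"
    using assms unfolding property_C_def by (cases "s \<ge> 0") auto
  moreover have "prob (- first_return_at_origin) = 1 - prob first_return_at_origin"
    using prob_compl[OF first_return_sets]
    by (simp add: Compl_eq_Diff_UNIV space_chain_law)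
  ultimately show ?thesis
    by (cases "p \<ge> 0")
       (simp_all add: emeasure_eq_measure ennreal_minus ennreal_leI ennreal_neg flip: ennreal_1)
qed

lemma property_C_escape:
  assumes "property_C p Q" "transl_inv Q" "\<bar>s\<bar> = 1"
  shows "escape Q (z, s) \<le> 1 - ennreal p"
proof -
  have "escape Q (z, s) = escape Q (0, s)"
    using escape_horizontal_shift[OF assms(2), of z "(0, s)"] by (simp add: horizontal_shift_def)
  also have "\<dots> \<le> emeasure (chain_law Q (0, s)) (- first_return_at_origin)"
    unfolding escape_def
    by (intro emeasure_mono first_return_compl_sets) (auto simp: first_return_at_origin_def)
  also note property_C_miss[OF assms(1,3)]
  finally show ?thesis .
qed

text \<open>
  The contraction behind the theorem: from height one, a return at \<open>z\<close>, where \<open>f\<close> vanishes, has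
  probability at least \<open>p\<close>.
\<close>
lemma property_C_exit_mean:
  assumes "property_C p Q" "transl_inv Q" "\<bar>s\<bar> = 1"
    and "\<And>y. f y \<le> c" "f (z, 0) = 0"
  shows "exit_mean Q f (z, s) \<le> (1 - ennreal p) * c"
proof -
  have "exit_mean Q f (z, s) = exit_mean Q (\<lambda>y. f (horizontal_shift z y)) (0, s)"
    using exit_mean_horizontal_shift[OF assms(2), of f z "(0, s)"] by (simp add: horizontal_shift_def)
  also have "\<dots> \<le> (\<integral>\<^sup>+\<omega>. c * indicator (- first_return_at_origin) \<omega> \<partial>chain_law Q (0, s))"
    unfolding exit_mean_def axis_pay_def
    by (intro nn_integral_mono)
       (auto simp: first_return_at_origin_def horizontal_shift_def assms(4,5) split: split_indicator)
  also have "\<dots> = c * emeasure (chain_law Q (0, s)) (- first_return_at_origin)"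
    by (rule nn_integral_cmult_indicator[OF first_return_compl_sets])
  also have "\<dots> \<le> c * (1 - ennreal p)"
    by (intro mult_left_mono property_C_miss[OF assms(1,3)]) simp
  finally show ?thesis by (simp add: mult.commute)
qed

lemma escape_successor:
  assumes "transl_inv Q" "escape Q (0, 0) = 0" "escape Q x = 0" "y \<in> set_pmf (Q x)"
  shows "escape Q y = 0"
proof (cases "snd y = 0")
  case True
  then show ?thesis
    using escape_horizontal_shift[OF assms(1), of "fst y" "(0, 0)"] assms(2)
    by (simp add: horizontal_shift_def) (metis prod.collapse)
next
  case False
  have "(\<integral>\<^sup>+y. (if snd y = 0 then 0 else escape Q y) \<partial>Q x) = 0"
    using escape_step[of Q x] assms(3) by simp
  then have "AE y in Q x. (if snd y = 0 then 0 else escape Q y) = 0"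
    by (subst (asm) nn_integral_0_iff_AE) auto
  then show ?thesis
    using assms(4) False by (auto simp: AE_measure_pmf_iff)
qed

lemma escape_le_1: "escape Q x \<le> 1"
  using prob_space.emeasure_le_1[OF prob_space_chain_law] by (simp add: escape_def)

text \<open>
  In a coupled pair, whenever the \<open>Q0\<close>-chain is on the axis the \<open>Q\<close>-chain has height \<open>-1\<close>, \<open>0\<close> or
  \<open>1\<close>; if it has not returned yet, property C(p) bounds its escape probability by \<open>1 - p\<close>.  By
  optional stopping this bound extends to all admissible positions \<open>(z, w)\<close>, \<open>w \<noteq> 0\<close>, coupled with a
  point \<open>(z, v)\<close> from which the \<open>Q0\<close>-chain almost surely returns.  A path that escapes must first
  survive \<open>n\<close> steps and then escape from where it stands, so the escape probability is at most
  \<open>1 - p\<close> times the probability of surviving \<open>n\<close> steps, which tends to the escape probability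
  itself.
\<close>
lemma coupled_property_F:
  assumes Q: "transl_inv Q" and Q0: "transl_inv Q0" "property_F Q0"
    and coup: "successfully_coupled Q Q0" and C: "property_C p Q" "p > 0"
  shows "property_F Q"
proof -
  note F0 = Q0(2)[unfolded property_F_iff_escape]
  define q where "q = 1 - ennreal p"
  \<comment> \<open>At height \<open>0\<close> the chain has already returned, hence the restriction to \<open>w \<noteq> 0\<close>.\<close>
  define F where "F y = (SUP w\<in>{w. w \<noteq> 0 \<and> \<bar>w\<bar> \<le> \<bar>snd y\<bar> + 1}. escape Q (fst y, w))" for y :: "int \<times> int"
  have F: "escape Q (z, w) \<le> F (z, v)" if "w \<noteq> 0" "\<bar>w\<bar> \<le> \<bar>v\<bar> + 1" for z v w
    unfolding F_def using that by (intro SUP_upper2[of w]) auto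
  have sub: "F y \<le> (\<integral>\<^sup>+y'. F y' \<partial>Q0 y)" for y
    unfolding F_def[of y]
  proof (rule SUP_least)
    fix w assume w: "w \<in> {w. w \<noteq> 0 \<and> \<bar>w\<bar> \<le> \<bar>snd y\<bar> + 1}"
    then show "escape Q (fst y, w) \<le> (\<integral>\<^sup>+y'. F y' \<partial>Q0 y)"
      using coupled_integral_le[OF coup, of w "snd y" "\<lambda>y. if snd y = 0 then 0 else escape Q y" F "fst y"] F
      by (simp add: escape_step[symmetric])
  qed
  have axis: "F (z, 0) \<le> q" for z
    unfolding F_def q_def by (rule SUP_least) (auto intro!: property_C_escape[OF C(1) Q])
  \<comment> \<open>Starting points from which the \<open>Q0\<close>-chain almost surely returns are preserved by its transitions.\<close>
  have good: "F y \<le> q" if "escape Q0 y = 0" for y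
  proof -
    have "F y \<le> exit_mean Q0 F y + escape Q0 y"
      by (rule subharmonic_le_exit[OF _ sub]) (auto simp: F_def escape_le_1 intro: SUP_least)
    also have "\<dots> \<le> q"
      using exit_mean_le[of F q Q0 y, OF axis] that by simp
    finally show ?thesis .
  qed
  have stay: "escape Q (z, w) \<le> q * stay Q n (z, w)"
    if "escape Q0 (z, v) = 0" "\<bar>w\<bar> \<le> \<bar>v\<bar> + 1" "w \<noteq> 0" for n z v w
    using that
  proof (induction n arbitrary: z v w)
    case 0
    then show ?case using F[of w v z] good[of "(z, v)"] by (simp add: stay_0)
  next
    case (Suc n)
    have "escape Q (z, w) = (\<integral>\<^sup>+y. (if snd y = 0 then 0 else escape Q y) \<partial>Q (z, w))"
      by (rule escape_step)
    also have "\<dots> \<le> (\<integral>\<^sup>+y. q * (if snd y = 0 then 0 else stay Q n y) \<partial>Q (z, w))"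
    proof (rule nn_integral_mono_AE, unfold AE_measure_pmf_iff, rule ballI)
      fix y assume "y \<in> set_pmf (Q (z, w))"
      then obtain v' where "(fst y, v') \<in> set_pmf (Q0 (z, v))" "\<bar>snd y\<bar> \<le> \<bar>v'\<bar> + 1"
        using coupled_successor[OF coup Suc.prems(2), of "fst y" "snd y" z] by auto
      then show "(if snd y = 0 then 0 else escape Q y) \<le> q * (if snd y = 0 then 0 else stay Q n y)"
        using Suc.IH[of "fst y" v' "snd y"] escape_successor[OF Q0(1) F0 Suc.prems(1)] by auto
    qed
    also have "\<dots> = q * stay Q (Suc n) (z, w)"
      by (simp add: nn_integral_cmult stay_Suc)
    finally show ?case .
  qed
  have null: "escape Q (z, w) = 0" if "escape Q0 (z, v) = 0" "\<bar>w\<bar> \<le> \<bar>v\<bar> + 1" "w \<noteq> 0" for z v w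
  proof (rule ennreal_contraction_zero[OF _ _ C(2)])
    have "(\<lambda>n. q * stay Q n (z, w)) \<longlonglongrightarrow> q * escape Q (z, w)"
      by (rule ennreal_tendsto_cmult[OF _ stay_LIMSEQ_escape]) (simp add: q_def less_top[symmetric])
    then show "escape Q (z, w) \<le> (1 - ennreal p) * escape Q (z, w)"
      unfolding q_def[symmetric] using stay[OF that] by (intro LIMSEQ_le_const) auto
    show "escape Q (z, w) < top"
      using escape_le_1[of Q "(z, w)"] by (simp add: le_less_trans)
  qed
  have "escape Q (0, 0) = (\<integral>\<^sup>+y. (if snd y = 0 then 0 else escape Q y) \<partial>Q (0, 0))"
    by (rule escape_step)
  also have "\<dots> = (\<integral>\<^sup>+y. 0 \<partial>Q (0, 0))"
  proof (rule nn_integral_cong_AE, unfold AE_measure_pmf_iff, rule ballI)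
    fix y assume "y \<in> set_pmf (Q (0, 0))"
    then obtain v' where "(fst y, v') \<in> set_pmf (Q0 (0, 0))" "\<bar>snd y\<bar> \<le> \<bar>v'\<bar> + 1"
      using coupled_successor[OF coup, of 0 0 "fst y" "snd y" 0] by auto
    then show "(if snd y = 0 then 0 else escape Q y) = 0"
      using null[of "fst y" v' "snd y"] escape_successor[OF Q0(1) F0 F0] by auto
  qed
  finally show ?thesis by (simp add: property_F_iff_escape)
qed

section \<open>Subharmonic functions of a recurrent walk\<close>

lemma measurable_int_add:
  fixes f g :: "'a \<Rightarrow> int"
  assumes f: "f \<in> M \<rightarrow>\<^sub>M count_space UNIV" and g: "g \<in> M \<rightarrow>\<^sub>M count_space UNIV"
  shows "(\<lambda>x. f x + g x) \<in> M \<rightarrow>\<^sub>M count_space UNIV"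
proof (rule measurable_compose_countable[where f = "\<lambda>i x. i + g x", OF _ f])
  fix i :: int
  show "(\<lambda>x. i + g x) \<in> M \<rightarrow>\<^sub>M count_space UNIV"
    by (rule measurable_compose[OF g]) simp
qed

text \<open>
  Optional stopping at the first visit of the recurrent walk to \<open>u\<close>.  In the proof \<open>B n z\<close> is the
  event that the walk from \<open>z\<close> avoids \<open>u\<close> at the times \<open>1, \<dots>, n\<close>; splitting off the first
  coordinate of the product space gives its one-step equation.
\<close>
lemma recurrent_law_subharmonic:
  assumes P: "prob_space P" "sets P = UNIV" and rec: "recurrent_law P"
    and f1: "\<And>z. f z \<le> 1" and sub: "\<And>z. f z \<le> (\<integral>\<^sup>+x. f (z + x) \<partial>P)"
  shows "f z \<le> f u"
proof -
  interpret P: prob_space P by fact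
  interpret S: sequence_space P by unfold_locales
  have walk: "(\<lambda>\<omega>. \<Sum>i<j. \<omega> i :: int) \<in> S.S \<rightarrow>\<^sub>M count_space UNIV" for j :: nat
  proof (induction j)
    case (Suc j)
    have "(\<lambda>\<omega>. \<omega> j) \<in> S.S \<rightarrow>\<^sub>M count_space (UNIV :: int set)"
      using measurable_component_singleton[of j UNIV "\<lambda>_. P"]
      by (simp add: measurable_cong_sets[OF refl, of P "count_space UNIV"] P(2))
    from measurable_int_add[OF Suc this] show ?case by simp
  qed simp
  define B where "B n z = {\<omega> \<in> space S.S. \<forall>j\<in>{1..n}. z + (\<Sum>i<j. \<omega> i) \<noteq> u}" for n :: nat and z
  have B: "B n z \<in> sets S.S" for n z
  proof -
    have "Measurable.pred S.S (\<lambda>\<omega>. z + (\<Sum>i<j. \<omega> i) \<noteq> u)" for j :: nat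
      by (rule measurable_compose[OF walk]) simp
    then have "Measurable.pred S.S (\<lambda>\<omega>. \<forall>j\<in>{1..n}. z + (\<Sum>i<j. \<omega> i) \<noteq> u)"
      by (intro pred_intros_finite) auto
    then show ?thesis by (simp add: B_def pred_def)
  qed
  have B_Suc: "emeasure S.S (B (Suc n) z) =
      (\<integral>\<^sup>+x. (if z + x = u then 0 else emeasure S.S (B n (z + x))) \<partial>P)" for n z
  proof -
    have cn: "(\<lambda>(s, \<omega>). case_nat s \<omega>) \<in> P \<Otimes>\<^sub>M S.S \<rightarrow>\<^sub>M S.S"
      by measurable
    have ind: "indicator (B (Suc n) z) (case_nat x \<omega>) =
        (if z + x = u then 0 else indicator (B n (z + x)) \<omega> :: ennreal)"
      if "x \<in> space P" "\<omega> \<in> space S.S" for x \<omega>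
    proof -
      have sp: "case_nat x \<omega> \<in> space S.S"
        using that by (auto simp: space_PiM PiE_iff split: nat.split)
      have "(\<forall>j\<in>{1..Suc n}. z + (\<Sum>i<j. case_nat x \<omega> i) \<noteq> u) \<longleftrightarrow>
          (\<forall>j\<in>{..n}. z + (\<Sum>i<Suc j. case_nat x \<omega> i) \<noteq> u)"
        unfolding image_Suc_atMost[symmetric] by blast
      also have "\<dots> \<longleftrightarrow> (\<forall>j\<in>{..n}. (z + x) + (\<Sum>i<j. \<omega> i) \<noteq> u)"
        by (simp add: sum.lessThan_Suc_shift add.assoc del: sum.lessThan_Suc)
      also have "\<dots> \<longleftrightarrow> z + x \<noteq> u \<and> (\<forall>j\<in>{1..n}. (z + x) + (\<Sum>i<j. \<omega> i) \<noteq> u)"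
      proof -
        have "{..n} = insert 0 {1..n}" by auto
        then show ?thesis by simp
      qed
      finally show ?thesis
        using that(2) sp by (auto simp: B_def split: split_indicator)
    qed
    have "emeasure S.S (B (Suc n) z) = (\<integral>\<^sup>+\<omega>. indicator (B (Suc n) z) \<omega> \<partial>S.S)"
      by (simp add: B)
    also have "\<dots> = (\<integral>\<^sup>+\<omega>. indicator (B (Suc n) z) \<omega> \<partial>distr (P \<Otimes>\<^sub>M S.S) S.S (\<lambda>(s, \<omega>). case_nat s \<omega>))"
      by (simp only: S.PiM_iter)
    also have "\<dots> = (\<integral>\<^sup>+y. indicator (B (Suc n) z) (case y of (s, \<omega>) \<Rightarrow> case_nat s \<omega>) \<partial>(P \<Otimes>\<^sub>M S.S))"
      using borel_measurable_indicator[OF B] by (intro nn_integral_distr[OF cn]) simp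
    also have "\<dots> = (\<integral>\<^sup>+x. \<integral>\<^sup>+\<omega>. indicator (B (Suc n) z) (case_nat x \<omega>) \<partial>S.S \<partial>P)"
      using measurable_compose[OF cn borel_measurable_indicator[OF B]]
      by (subst S.nn_integral_fst[symmetric]) (auto simp: case_prod_unfold)
    also have "\<dots> = (\<integral>\<^sup>+x. \<integral>\<^sup>+\<omega>. (if z + x = u then 0 else indicator (B n (z + x)) \<omega>) \<partial>S.S \<partial>P)"
      by (intro nn_integral_cong) (simp add: ind)
    also have "\<dots> = (\<integral>\<^sup>+x. (if z + x = u then 0 else emeasure S.S (B n (z + x))) \<partial>P)"
      by (intro nn_integral_cong) (simp add: B)
    finally show ?thesis .
  qed
  have meas: "h \<in> borel_measurable P" for h :: "int \<Rightarrow> ennreal"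
    by (simp add: measurable_cong_sets[of P "count_space UNIV"] P(2))
  have le: "f z \<le> f u + emeasure S.S (B n z)" for n z
  proof (induction n arbitrary: z)
    case 0
    have "B 0 z = space S.S" by (simp add: B_def)
    then show ?case using f1[of z] by (simp add: S.P.emeasure_space_1 add_increasing)
  next
    case (Suc n)
    have "f z \<le> (\<integral>\<^sup>+x. f (z + x) \<partial>P)" by (rule sub)
    also have "\<dots> \<le> (\<integral>\<^sup>+x. f u + (if z + x = u then 0 else emeasure S.S (B n (z + x))) \<partial>P)"
      using Suc by (intro nn_integral_mono) auto
    also have "\<dots> = f u + emeasure S.S (B (Suc n) z)"
      by (subst nn_integral_add) (auto simp: meas B_Suc P.emeasure_space_1)
    finally show ?case .
  qed
  have "AE \<omega> in S.S. infinite {n. (\<Sum>j<n. \<omega> j) = u - z}"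
    using rec by (simp add: recurrent_law_def recurrent_process_def)
  then have "AE \<omega> in S.S. \<omega> \<notin> (\<Inter>n. B n z)"
  proof eventually_elim
    case (elim \<omega>)
    then obtain n where n: "n \<ge> 1" "(\<Sum>j<n. \<omega> j) = u - z"
      unfolding infinite_nat_iff_unbounded_le by blast
    then have "\<omega> \<notin> B n z" by (force simp: B_def)
    then show ?case by blast
  qed
  then have "emeasure S.S (\<Inter>n. B n z) = 0"
    using B AE_iff_null_sets[of "\<Inter>n. B n z" S.S]
    by (simp add: null_sets_def sets.countable_INT image_subset_iff)
  then have "(\<lambda>n. emeasure S.S (B n z)) \<longlonglongrightarrow> 0"
    using Lim_emeasure_decseq[of "\<lambda>n. B n z" S.S] B by (force simp: decseq_def B_def image_subset_iff)
  then show ?thesis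
    using le by (intro LIMSEQ_le_const[OF tendsto_add[OF tendsto_const, of _ 0, simplified]]) auto
qed

section \<open>Avoidance bounds vanish\<close>

text \<open>
  The hypothesis on \<open>g\<close> is the one-step bound for the best chance of avoiding \<open>u\<close> when an opponent
  chooses the index of each step.  Its supremum over indices is handled all at once by lifting
  \<open>g\<close> to the plane: for \<open>w \<noteq> 0\<close>, \<open>H i (z, w)\<close> is the expectation of \<open>g\<close> at the next return of
  the \<open>i\<close>-th chain, and \<open>F (z, v)\<close> the supremum over all indices and all heights \<open>w\<close> that the coupling allows at
  height \<open>v\<close>.  Then \<open>F\<close> is subharmonic for \<open>Q0\<close>, its values on the axis are maximal at \<open>u\<close>, and
  there property C(p) forces \<open>F (u, 0) \<le> (1 - p) F (u, 0)\<close>.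
\<close>
lemma avoidance_bound_vanishes:
  fixes Q :: "nat \<Rightarrow> int \<times> int \<Rightarrow> (int \<times> int) pmf"
  assumes Q0: "transl_inv Q0" "property_F Q0" "recurrent_law (phi Q0)"
    and Q: "\<And>i. i \<in> J \<Longrightarrow> transl_inv (Q i)"
    and coup: "\<And>i. i \<in> J \<Longrightarrow> successfully_coupled (Q i) Q0"
    and C: "\<And>i. i \<in> J \<Longrightarrow> property_C p (Q i)" "p > 0"
    and g: "\<And>z. g z \<le> 1" "g u = 0"
    and step: "\<And>z. z \<noteq> u \<Longrightarrow> g z \<le> (SUP i\<in>J. \<integral>\<^sup>+x. g (z + x) \<partial>phi (Q i))"
  shows "g z = 0"
proof (cases "J = {}")
  case True
  then show ?thesis using step[of z] g(2) by (cases "z = u") (auto simp: bot_ennreal)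
next
  case False
  define G where "G i = exit_mean (Q i) (\<lambda>y. g (fst y))" for i
  have G_axis: "G i (z, 0) = (\<integral>\<^sup>+x. g (z + x) \<partial>phi (Q i))" if "i \<in> J" for i z
    using exit_mean_axis_eq_phi[OF Q[OF that] coupled_property_F[OF Q[OF that] Q0(1,2) coup[OF that] C(1)[OF that] C(2)]]
    by (simp add: G_def)
  \<comment> \<open>On the axis the excursion is over, and the opponent has not yet chosen the next index.\<close>
  define H where "H i y = (if snd y = 0 then g (fst y) else G i y)" for i y
  have G_step: "G i y = (\<integral>\<^sup>+y'. H i y' \<partial>Q i y)" for i y
    unfolding G_def H_def by (rule exit_mean_step)
  define F where "F y = (SUP i\<in>J. SUP w\<in>{w. \<bar>w\<bar> \<le> \<bar>snd y\<bar> + 1}. H i (fst y, w))" for y :: "int \<times> int"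
  have F: "H i (z, w) \<le> F (z, v)" if "i \<in> J" "\<bar>w\<bar> \<le> \<bar>v\<bar> + 1" for i z v w
    unfolding F_def using that by (intro SUP_upper2[of i] SUP_upper2[of w]) auto
  have H1: "H i y \<le> 1" for i y
    using g(1) exit_mean_le[of "\<lambda>y. g (fst y)" 1] by (simp add: H_def G_def)
  have G_F: "G i (z, w) \<le> (\<integral>\<^sup>+y. F y \<partial>Q0 (z, v))" if "i \<in> J" "\<bar>w\<bar> \<le> \<bar>v\<bar> + 1" for i z v w
    unfolding G_step using F that(1) by (intro coupled_integral_le[OF coup[OF that(1)] that(2)])
  have sub: "F y \<le> (\<integral>\<^sup>+y'. F y' \<partial>Q0 y)" for y
    unfolding F_def[of y]
  proof (intro SUP_least)
    fix i w assume i: "i \<in> J" and w: "w \<in> {w. \<bar>w\<bar> \<le> \<bar>snd y\<bar> + 1}"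
    show "H i (fst y, w) \<le> (\<integral>\<^sup>+y'. F y' \<partial>Q0 y)"
    proof (cases "w = 0")
      \<comment> \<open>Inside an excursion the index stays \<open>i\<close>.\<close>
      case False
      then show ?thesis using G_F[OF i, of w "snd y" "fst y"] w by (simp add: H_def)
    next
      case True
      show ?thesis
      proof (cases "fst y = u")
        \<comment> \<open>A new index is chosen here; \<open>F\<close> is a supremum over indices, so it bounds every choice.\<close>
        case False
        then have "g (fst y) \<le> (SUP i\<in>J. G i (fst y, 0))"
          using step G_axis by simp
        also have "\<dots> \<le> (\<integral>\<^sup>+y'. F y' \<partial>Q0 y)"
          using G_F[of _ 0 "snd y" "fst y"] by (intro SUP_least) simp
        finally show ?thesis using True by (simp add: H_def)
      qed (use True g(2) in \<open>simp add: H_def\<close>)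
    qed
  qed
  have axis: "F (z, 0) \<le> F (u, 0)" for z
  proof (rule recurrent_law_subharmonic[OF prob_space_phi _ Q0(3)])
    show "F (z, 0) \<le> 1" for z
      unfolding F_def by (intro SUP_least H1)
    show "F (z, 0) \<le> (\<integral>\<^sup>+x. F (z + x, 0) \<partial>phi Q0)" for z
    proof -
      have "F (z, 0) \<le> exit_mean Q0 F (z, 0) + escape Q0 (z, 0)"
        by (rule subharmonic_le_exit[OF _ sub]) (auto simp: F_def intro!: SUP_least H1)
      also have "escape Q0 (z, 0) = 0"
        using escape_horizontal_shift[OF Q0(1), of z "(0, 0)"] Q0(2)
        by (simp add: horizontal_shift_def property_F_iff_escape)
      finally show ?thesis by (simp add: exit_mean_axis_eq_phi[OF Q0(1,2)])
    qed
  qed (simp add: phi_def)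
  have gF: "g z \<le> F (u, 0)" for z
  proof -
    obtain i where "i \<in> J" using False by blast
    then have "g z \<le> F (z, 0)" using F[of i 0 0 z] by (simp add: H_def)
    then show ?thesis using axis[of z] by simp
  qed
  \<comment> \<open>The admissible heights are \<open>0\<close>, where \<open>g u = 0\<close> is read off, and \<open>1\<close> and \<open>-1\<close>, where C(p) applies.\<close>
  have "F (u, 0) \<le> (1 - ennreal p) * F (u, 0)"
    unfolding F_def[of "(u, 0)"]
  proof (intro SUP_least)
    fix i w assume i: "i \<in> J" and w: "w \<in> {w. \<bar>w\<bar> \<le> \<bar>snd (u, 0::int)\<bar> + 1}"
    have "H i (u, w) \<le> (1 - ennreal p) * F (u, 0)"
    proof (cases "w = 0")
      case False
      then show ?thesis
        using property_C_exit_mean[OF C(1)[OF i] Q[OF i], of w "\<lambda>y. g (fst y)" "F (u, 0)" u] w gF g(2)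
        by (simp add: H_def G_def)
    qed (simp add: H_def g(2))
    then show "H i (fst (u, 0::int), w) \<le> (1 - ennreal p) *
        (SUP i\<in>J. SUP w\<in>{w. \<bar>w\<bar> \<le> \<bar>snd (u, 0::int)\<bar> + 1}. H i (fst (u, 0::int), w))"
      by (simp add: F_def)
  qed
  moreover have "F (u, 0) \<le> 1"
    unfolding F_def by (intro SUP_least H1)
  then have "F (u, 0) < top" by (simp add: le_less_trans)
  ultimately have "F (u, 0) = 0"
    using C(2) by (rule ennreal_contraction_zero)
  then show ?thesis using gF[of z] by simp
qed

section \<open>Avoidance probabilities of a process satisfying (CL)\<close>

lemma emeasure_partition:
  fixes f :: "'a \<Rightarrow> 'b::countable"
  assumes f: "f \<in> M \<rightarrow>\<^sub>M count_space UNIV" and X: "X \<in> sets M"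
  shows "emeasure M X = (\<integral>\<^sup>+z. emeasure M (X \<inter> {\<omega> \<in> space M. f \<omega> = z}) \<partial>count_space UNIV)"
proof -
  have "{\<omega> \<in> space M. f \<omega> = z} \<in> sets M" for z
    using measurable_sets[OF f, of "{z}"] by (simp add: vimage_def Int_def conj_commute)
  then have "emeasure M (\<Union>z. X \<inter> {\<omega> \<in> space M. f \<omega> = z}) =
      (\<integral>\<^sup>+z. emeasure M (X \<inter> {\<omega> \<in> space M. f \<omega> = z}) \<partial>count_space UNIV)"
    using X by (intro emeasure_UN_countable) (auto simp: disjoint_family_on_def)
  moreover have "(\<Union>z. X \<inter> {\<omega> \<in> space M. f \<omega> = z}) = X"
    using sets.sets_into_space[OF X] by auto
  ultimately show ?thesis by simp
qed

lemma nn_integral_countable_atoms: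
  fixes P :: "'a::countable measure"
  assumes "sets P = UNIV"
  shows "(\<integral>\<^sup>+x. f x \<partial>P) = (\<integral>\<^sup>+x. emeasure P {x} * f x \<partial>count_space UNIV)"
proof -
  have "P = density (count_space UNIV) (\<lambda>x. emeasure P {x})"
  proof (rule measure_eqI_countable[of _ UNIV])
    fix a :: 'a
    have "emeasure (density (count_space UNIV) (\<lambda>x. emeasure P {x})) {a} =
        (\<integral>\<^sup>+x. emeasure P {a} * indicator {a} x \<partial>count_space UNIV)"
      by (subst emeasure_density) (auto intro!: nn_integral_cong split: split_indicator)
    then show "emeasure P {a} = emeasure (density (count_space UNIV) (\<lambda>x. emeasure P {x})) {a}"
      by (simp add: nn_integral_cmult)
  qed (use assms in auto)
  then have "(\<integral>\<^sup>+x. f x \<partial>P) = (\<integral>\<^sup>+x. f x \<partial>density (count_space UNIV) (\<lambda>x. emeasure P {x}))"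
    by simp
  also have "\<dots> = (\<integral>\<^sup>+x. emeasure P {x} * f x \<partial>count_space UNIV)"
    by (rule nn_integral_density) auto
  finally show ?thesis .
qed

context
  fixes M :: "'w measure" and k :: enat and P :: "nat \<Rightarrow> int measure"
    and S :: "nat \<Rightarrow> 'w \<Rightarrow> int" and I :: "nat \<Rightarrow> 'w \<Rightarrow> nat"
  assumes M: "prob_space M" and CL: "CL M k P S I"
begin

interpretation prob_space M by (rule M)

lemma CL_measurable_S: "S n \<in> M \<rightarrow>\<^sub>M count_space UNIV"
  using CL by (simp add: CL_def)

lemma CL_measurable_I: "n \<ge> 1 \<Longrightarrow> I n \<in> M \<rightarrow>\<^sub>M count_space UNIV"
  using CL by (simp add: CL_def)

lemma hist_gen_subset:
  "{S l -` A \<inter> space M | l A. l \<le> n} \<union> {I l -` A \<inter> space M | l A. 1 \<le> l \<and> l \<le> Suc n} \<subseteq> sets M"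
  using measurable_sets[OF CL_measurable_S] measurable_sets[OF CL_measurable_I] by auto

lemma sets_hist_next:
  "sets (hist_next M S I n) = sigma_sets (space M)
     ({S l -` A \<inter> space M | l A. l \<le> n} \<union> {I l -` A \<inter> space M | l A. 1 \<le> l \<and> l \<le> Suc n})"
  unfolding hist_next_def using hist_gen_subset[of n] sets.space_closed[of M]
  by (intro sets_measure_of) (rule order_trans)

lemma space_hist_next: "space (hist_next M S I n) = space M"
  by (simp add: hist_next_def space_measure_of_conv)

lemma subalgebra_hist_next: "subalgebra M (hist_next M S I n)"
  unfolding subalgebra_def space_hist_next sets_hist_next
  using sets.sigma_sets_subset[OF hist_gen_subset] by simp

lemma hist_next_sets: "E \<in> sets (hist_next M S I n) \<Longrightarrow> E \<in> sets M"
  using subalgebra_hist_next by (auto simp: subalgebra_def)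

lemma S_in_hist_next: "l \<le> n \<Longrightarrow> {\<omega> \<in> space M. S l \<omega> = z} \<in> sets (hist_next M S I n)"
  unfolding sets_hist_next
  by (rule sigma_sets.Basic, rule UnI1, rule CollectI, rule exI[of _ l], rule exI[of _ "{z}"]) auto

lemma I_in_hist_next: "{\<omega> \<in> space M. I (Suc n) \<omega> = i} \<in> sets (hist_next M S I n)"
  unfolding sets_hist_next
  by (rule sigma_sets.Basic, rule UnI2, rule CollectI, rule exI[of _ "Suc n"], rule exI[of _ "{i}"]) auto

lemma hist_next_mono: "sets (hist_next M S I n) \<subseteq> sets (hist_next M S I (Suc n))"
  unfolding sets_hist_next by (intro sigma_sets_mono' Un_mono) (blast intro: le_SucI)+

text \<open>
  Since \<open>E\<close> belongs to the conditioning sigma-algebra, integrating the conditional probability in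
  (CL) over \<open>E\<close> gives the probability of the joint event; on \<open>E\<close> the integrand is constant because
  \<open>I (n + 1)\<close> is.
\<close>
lemma CL_next_step:
  assumes E: "E \<in> sets (hist_next M S I n)" and Ei: "\<And>\<omega>. \<omega> \<in> E \<Longrightarrow> I (Suc n) \<omega> = i"
    and Ez: "\<And>\<omega>. \<omega> \<in> E \<Longrightarrow> S n \<omega> = z" and P: "prob_space (P i)"
  shows "emeasure M (E \<inter> {\<omega> \<in> space M. S (Suc n) \<omega> = z'}) = emeasure M E * emeasure (P i) {z' - z}"
proof -
  interpret F: finite_measure_subalgebra M "hist_next M S I n"
    using subalgebra_hist_next by unfold_locales
  interpret Pi: prob_space "P i" by fact
  let ?f = "\<lambda>\<omega>. indicator {z' - z} (S (Suc n) \<omega> - S n \<omega>) :: real"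
  note EM[measurable] = hist_next_sets[OF E]
  have EM': "E \<subseteq> space M" using sets.sets_into_space[OF EM] .
  have "(\<lambda>\<omega>. S (Suc n) \<omega> + (- S n \<omega>)) \<in> M \<rightarrow>\<^sub>M count_space UNIV"
    by (intro measurable_int_add CL_measurable_S measurable_compose[OF CL_measurable_S, of uminus]) simp
  then have D: "(\<lambda>\<omega>. S (Suc n) \<omega> - S n \<omega>) \<in> M \<rightarrow>\<^sub>M count_space UNIV" by simp
  have f: "?f \<in> borel_measurable M"
    by (rule measurable_compose[OF D]) simp
  have int: "integrable M ?f"
    by (rule integrable_const_bound[of _ 1]) (auto simp: f split: split_indicator)
  have eq: "E \<inter> {\<omega> \<in> space M. S (Suc n) \<omega> = z'} = {\<omega> \<in> E. S (Suc n) \<omega> - S n \<omega> = z' - z}"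
    using EM' Ez by auto
  have Z: "{\<omega> \<in> space M. S (Suc n) \<omega> = z'} \<in> sets M"
    using hist_next_sets[OF S_in_hist_next[of "Suc n" "Suc n"]] by simp
  have "prob (E \<inter> {\<omega> \<in> space M. S (Suc n) \<omega> = z'}) =
      (\<integral>\<omega>. indicator (E \<inter> {\<omega> \<in> space M. S (Suc n) \<omega> = z'}) \<omega> \<partial>M)"
    using EM Z by simp
  also have "\<dots> = (\<integral>\<omega>\<in>E. ?f \<omega> \<partial>M)"
    unfolding set_lebesgue_integral_def eq
    by (intro Bochner_Integration.integral_cong) (auto split: split_indicator)
  also have "\<dots> = (\<integral>\<omega>\<in>E. real_cond_exp M (hist_next M S I n) ?f \<omega> \<partial>M)"
    by (rule F.real_cond_exp_intA[OF int E])
  also have "\<dots> = (\<integral>\<omega>\<in>E. measure (P i) {z' - z} \<partial>M)"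
  proof (rule set_lebesgue_integral_cong_AE)
    have "AE \<omega> in M. real_cond_exp M (hist_next M S I n) ?f \<omega> = measure (P (I (Suc n) \<omega>)) {z' - z}"
      using CL by (simp add: CL_def)
    then show "AE \<omega>\<in>E in M. real_cond_exp M (hist_next M S I n) ?f \<omega> = measure (P i) {z' - z}"
      by eventually_elim (auto simp: Ei)
  qed auto
  also have "\<dots> = prob E * measure (P i) {z' - z}"
    using EM by (simp add: set_lebesgue_integral_def)
  finally show ?thesis
    by (simp add: emeasure_eq_measure Pi.emeasure_eq_measure ennreal_mult)
qed

definition avoid :: "int \<Rightarrow> nat \<Rightarrow> 'w set" where
  "avoid u n = {\<omega> \<in> space M. \<forall>m>n. S m \<omega> \<noteq> u}"

lemma avoid_sets: "avoid u n \<in> sets M"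
proof -
  have "Measurable.pred M (\<lambda>\<omega>. m > n \<longrightarrow> S m \<omega> \<noteq> u)" for m
    by (rule measurable_compose[OF CL_measurable_S[of m], of "\<lambda>s. m > n \<longrightarrow> s \<noteq> u"]) simp
  from pred_intros_countable(1)[OF this] show ?thesis
    by (simp only: avoid_def pred_def)
qed

lemma avoid_Suc: "avoid u n = {\<omega> \<in> avoid u (Suc n). S (Suc n) \<omega> \<noteq> u}"
proof -
  have "(\<forall>m>n. S m \<omega> \<noteq> u) \<longleftrightarrow> S (Suc n) \<omega> \<noteq> u \<and> (\<forall>m>Suc n. S m \<omega> \<noteq> u)" for \<omega>
    by (metis Suc_lessD Suc_lessI lessI)
  then show ?thesis by (auto simp: avoid_def)
qed

text \<open>
  One step of dynamic programming.  An event of the past with \<open>S n = z\<close> is split according to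
  \<open>I (n + 1)\<close> and then \<open>S (n + 1)\<close>.  Each piece is again an event of the past, one step later, with
  known position, so \<open>g\<close> bounds its share; the piece with \<open>S (n + 1) = u\<close> contributes nothing, which
  matches \<open>g u = 0\<close>.
\<close>
lemma CL_avoid_le:
  assumes P: "\<And>i. i \<in> idx k \<Longrightarrow> prob_space (P i)" "\<And>i. sets (P i) = UNIV"
    and g: "g u = 0"
      "\<And>z n E. z \<noteq> u \<Longrightarrow> E \<in> sets (hist_next M S I n) \<Longrightarrow> E \<subseteq> {\<omega>. S n \<omega> = z} \<Longrightarrow>
         emeasure M (E \<inter> avoid u n) \<le> g z * emeasure M E"
    and E: "E \<in> sets (hist_next M S I n)" "E \<subseteq> {\<omega>. S n \<omega> = z}"
  shows "emeasure M (E \<inter> avoid u n) \<le> (SUP i\<in>idx k. \<integral>\<^sup>+x. g (z + x) \<partial>P i) * emeasure M E"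
    (is "_ \<le> ?B * _")
proof -
  let ?H = "\<lambda>n. sets (hist_next M S I n)"
  let ?I = "\<lambda>i. {\<omega> \<in> space M. I (Suc n) \<omega> = i}" and ?S = "\<lambda>z'. {\<omega> \<in> space M. S (Suc n) \<omega> = z'}"
  have EM: "E \<in> sets M" by (rule hist_next_sets[OF E(1)])
  have part: "emeasure M ((E \<inter> ?I i) \<inter> avoid u n) \<le> ?B * emeasure M (E \<inter> ?I i)" for i
  proof (cases "i \<in> idx k")
    case False
    then have "E \<inter> ?I i = {}" using CL by (auto simp: CL_def)
    then show ?thesis by (simp only: Int_empty_left emeasure_empty zero_le)
  next
    case True
    have Ei: "E \<inter> ?I i \<in> ?H n" using E(1) I_in_hist_next by auto
    have "emeasure M ((E \<inter> ?I i) \<inter> avoid u n) =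
        (\<integral>\<^sup>+z'. emeasure M ((E \<inter> ?I i) \<inter> avoid u n \<inter> ?S z') \<partial>count_space UNIV)"
      using hist_next_sets[OF Ei] avoid_sets by (intro emeasure_partition[OF CL_measurable_S]) auto
    also have "\<dots> \<le> (\<integral>\<^sup>+z'. g z' * emeasure M (E \<inter> ?I i \<inter> ?S z') \<partial>count_space UNIV)"
    proof (rule nn_integral_mono)
      fix z' :: int
      have E': "E \<inter> ?I i \<inter> ?S z' \<in> ?H (Suc n)"
        using Ei hist_next_mono[of n] S_in_hist_next[of "Suc n" "Suc n"] by blast
      have split: "(E \<inter> ?I i) \<inter> avoid u n \<inter> ?S z' =
          (if z' = u then {} else (E \<inter> ?I i \<inter> ?S z') \<inter> avoid u (Suc n))"
        by (subst avoid_Suc) auto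
      show "emeasure M ((E \<inter> ?I i) \<inter> avoid u n \<inter> ?S z') \<le> g z' * emeasure M (E \<inter> ?I i \<inter> ?S z')"
        unfolding split using g(2)[OF _ E', of z'] by auto
    qed
    also have "\<dots> = (\<integral>\<^sup>+z'. emeasure M (E \<inter> ?I i) * (emeasure (P i) {z' - z} * g z') \<partial>count_space UNIV)"
    proof (rule nn_integral_cong)
      fix z' :: int
      have "emeasure M (E \<inter> ?I i \<inter> ?S z') = emeasure M (E \<inter> ?I i) * emeasure (P i) {z' - z}"
        using E(2) by (intro CL_next_step[OF Ei _ _ P(1)[OF True]]) auto
      then show "g z' * emeasure M (E \<inter> ?I i \<inter> ?S z') =
          emeasure M (E \<inter> ?I i) * (emeasure (P i) {z' - z} * g z')"
        by (simp add: mult_ac)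
    qed
    also have "\<dots> = emeasure M (E \<inter> ?I i) * (\<integral>\<^sup>+z'. emeasure (P i) {z' - z} * g z' \<partial>count_space UNIV)"
      by (rule nn_integral_cmult) simp
    also have "(\<integral>\<^sup>+z'. emeasure (P i) {z' - z} * g z' \<partial>count_space UNIV) = (\<integral>\<^sup>+x. g (z + x) \<partial>P i)"
      unfolding nn_integral_countable_atoms[OF P(2)]
      by (subst nn_integral_bij_count_space[where g = "\<lambda>x. z + x" and A = UNIV, symmetric])
         (auto intro!: bij_betw_byWitness[where f' = "\<lambda>x. x - z"])
    also have "emeasure M (E \<inter> ?I i) * \<dots> \<le> ?B * emeasure M (E \<inter> ?I i)"
      using True by (subst mult.commute) (intro mult_right_mono SUP_upper, auto)
    finally show ?thesis .
  qed
  have "emeasure M (E \<inter> avoid u n) = (\<integral>\<^sup>+i. emeasure M ((E \<inter> avoid u n) \<inter> ?I i) \<partial>count_space UNIV)"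
    using EM avoid_sets by (intro emeasure_partition[OF CL_measurable_I]) auto
  also have "\<dots> \<le> (\<integral>\<^sup>+i. ?B * emeasure M (E \<inter> ?I i) \<partial>count_space UNIV)"
    using part by (intro nn_integral_mono) (simp add: Int_ac)
  also have "\<dots> = ?B * emeasure M E"
    by (subst nn_integral_cmult) (simp_all add: emeasure_partition[OF CL_measurable_I EM, of "Suc n"])
  finally show ?thesis .
qed

text \<open>
  The supremum \<open>g\<close> of the conditional probabilities of avoiding \<open>u\<close> satisfies the one-step bound,
  so it vanishes by hypothesis.  One more step covers the events with \<open>S n = u\<close>, on which \<open>g\<close> was
  set to \<open>0\<close> by definition.
\<close>
lemma CL_recurrent_if_avoidance_bounds_vanish:
  assumes P: "\<And>i. i \<in> idx k \<Longrightarrow> prob_space (P i)" "\<And>i. sets (P i) = UNIV"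
    and vanish: "\<And>u g z. (\<And>z. g z \<le> 1) \<Longrightarrow> g u = 0 \<Longrightarrow>
        (\<And>z. z \<noteq> u \<Longrightarrow> g z \<le> (SUP i\<in>idx k. \<integral>\<^sup>+x. g (z + x) \<partial>P i)) \<Longrightarrow> g z = (0 :: ennreal)"
  shows "recurrent_process M S"
  unfolding recurrent_process_def
proof
  fix u :: int
  let ?H = "\<lambda>n. sets (hist_next M S I n)"
  \<comment> \<open>Past events may constrain \<open>I (n + 1)\<close> too; this makes the family closed under the splitting above.\<close>
  define \<E> where "\<E> z = {(n, E). E \<in> ?H n \<and> E \<subseteq> {\<omega>. S n \<omega> = z} \<and> emeasure M E \<noteq> 0}" for z
  define g where "g z = (if z = u then 0 else
      (SUP (n, E)\<in>\<E> z. emeasure M (E \<inter> avoid u n) / emeasure M E))" for z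
  have quot_le: "emeasure M X / emeasure M E \<le> c"
    if "emeasure M X \<le> c * emeasure M E" "emeasure M E \<noteq> 0" for X E c
    using that by (intro divide_le_posI_ennreal) (auto simp: zero_less_iff_neq_zero mult.commute)
  have bound: "emeasure M (E \<inter> avoid u n) \<le> g z * emeasure M E"
    if "z \<noteq> u" "E \<in> ?H n" "E \<subseteq> {\<omega>. S n \<omega> = z}" for z n E
  proof (cases "emeasure M E = 0")
    case True
    then show ?thesis
      using emeasure_mono[of "E \<inter> avoid u n" E M] hist_next_sets[OF that(2)] by simp
  next
    case False
    then have "emeasure M (E \<inter> avoid u n) / emeasure M E \<le> g z"
      using that unfolding g_def by (auto intro!: SUP_upper2[of "(n, E)"] simp: \<E>_def)
    then have "emeasure M (E \<inter> avoid u n) / emeasure M E * emeasure M E \<le> g z * emeasure M E"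
      by (rule mult_right_mono) simp
    moreover have "emeasure M (E \<inter> avoid u n) / emeasure M E * emeasure M E = emeasure M (E \<inter> avoid u n)"
      using False by (simp add: emeasure_eq_measure divide_ennreal zero_less_measure_iff flip: ennreal_mult)
    ultimately show ?thesis by simp
  qed
  have "g u = 0" by (simp add: g_def)
  then have step: "emeasure M (E \<inter> avoid u n) \<le> (SUP i\<in>idx k. \<integral>\<^sup>+x. g (z + x) \<partial>P i) * emeasure M E"
    if "E \<in> ?H n" "E \<subseteq> {\<omega>. S n \<omega> = z}" for n E z
    using bound that by (intro CL_avoid_le[OF P])
  have g0: "g z = 0" for z
  proof (rule vanish[of g u])
    show "g z \<le> 1" for z
      unfolding g_def using emeasure_mono[of _ _ M, OF Int_lower1] hist_next_sets
      by (auto intro!: SUP_least quot_le simp: \<E>_def)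
    show "g z \<le> (SUP i\<in>idx k. \<integral>\<^sup>+x. g (z + x) \<partial>P i)" if "z \<noteq> u" for z
      unfolding g_def[of z] using that by (auto intro!: SUP_least quot_le step simp: \<E>_def)
  qed (simp add: g_def)
  have null: "emeasure M (avoid u n) = 0" for n
  proof -
    have "emeasure M (avoid u n) = (\<integral>\<^sup>+z. emeasure M (avoid u n \<inter> {\<omega> \<in> space M. S n \<omega> = z}) \<partial>count_space UNIV)"
      by (rule emeasure_partition[OF CL_measurable_S avoid_sets])
    also have "\<dots> \<le> (\<integral>\<^sup>+z. 0 \<partial>count_space (UNIV :: int set))"
    proof (rule nn_integral_mono)
      fix z :: int
      show "emeasure M (avoid u n \<inter> {\<omega> \<in> space M. S n \<omega> = z}) \<le> 0"
      proof -
        have "(SUP i\<in>idx k. \<integral>\<^sup>+x. g (z + x) \<partial>P i) \<le> 0"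
          by (intro SUP_least) (simp add: g0)
        then show ?thesis
          using step[OF S_in_hist_next[of n n z], of z] by (auto simp: Int_commute)
      qed
    qed
    finally show ?thesis by simp
  qed
  have "AE \<omega> in M. \<omega> \<notin> avoid u n" for n
    using null[of n] avoid_sets[of u n] by (simp add: AE_iff_null_sets[symmetric] null_sets_def)
  then have "AE \<omega> in M. \<forall>n. \<omega> \<notin> avoid u n"
    by (simp add: AE_all_countable)
  then show "AE \<omega> in M. infinite {n. S n \<omega> = u}"
    using AE_space by eventually_elim (auto simp: infinite_nat_iff_unbounded avoid_def)
qed

end

theorem theorem2p5:
  fixes k :: enat
    and Q :: "nat \<Rightarrow> int \<times> int \<Rightarrow> (int \<times> int) pmf"
    and p :: real
    and M :: "'w measure"
    and S :: "nat \<Rightarrow> 'w \<Rightarrow> int"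
    and I :: "nat \<Rightarrow> 'w \<Rightarrow> nat"
  assumes "k \<ge> 1"
    and "\<And>i. enat i \<le> k \<Longrightarrow> transl_inv (Q i)"
    and "\<And>i. i \<in> idx k \<Longrightarrow> successfully_coupled (Q i) (Q 0)"
    and "property_F (Q 0)"
    and "recurrent_law (phi (Q 0))"
    and "p > 0"
    and "\<And>i. i \<in> idx k \<Longrightarrow> property_C p (Q i)"
    and "prob_space M"
    and "CL M k (\<lambda>i. phi (Q i)) S I"
  shows "recurrent_process M S"
proof (rule CL_recurrent_if_avoidance_bounds_vanish[OF assms(8,9)])
  fix u z :: int and g :: "int \<Rightarrow> ennreal"
  assume "\<And>z. g z \<le> 1" "g u = 0"
    "\<And>z. z \<noteq> u \<Longrightarrow> g z \<le> (SUP i\<in>idx k. \<integral>\<^sup>+x. g (z + x) \<partial>phi (Q i))"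
  moreover have "transl_inv (Q 0)"
    using assms(2)[of 0] by (simp add: zero_enat_def[symmetric])
  moreover have "\<And>i. i \<in> idx k \<Longrightarrow> transl_inv (Q i)"
    using assms(2) by (simp add: idx_def)
  ultimately show "g z = 0"
    using assms(3-7) by (intro avoidance_bound_vanishes[of "Q 0" "idx k" Q p g u z]) auto
qed (simp_all add: prob_space_phi, simp add: phi_def)

end
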